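(* Let $F=(f_1,\ldots,f_k):\mathbb{A}^n\to\mathbb{A}^k$, $n\ge k$, be a real, complex or mixed polynomial mapping such that $F(0)=0$. Suppose that $F$ is non-degenerate at infinity and that $f_i$ is convenient for every $i=1,\ldots,k$. Then $K_\infty(F)=\emptyset$.
   Context: **Mappings.** $F=(f_1,\ldots,f_k):\mathbb{A}^n\to\mathbb{A}^k$ is of one of three types: real ($\mathbb{A}=\mathbb{R}$, $f_j$ real polynomials), complex ($\mathbb{A}=\mathbb{C}$, $f_j$ complex polynomials in $z$), or mixed ($\mathbb{A}=\mathbb{C}$, $f_j$ polynomials in $z$ and $\bar z$ with complex coefficients). $\mathbb{A}^*=\mathbb{A}\setminus\{0\}$. For a map, $\operatorname{Sing}$ denotes the set of points where the differential is not surjective; for mixed maps this is the real differential of the underlying real map ($\mathbb{C}=\mathbb{R}^2$). **Asymptotic critical values.** For a $C^1$ real semi-algebraic map $F:\mathbb{A}^n\to\mathbb{A}^k$, $K_\infty(F)$ is the set of $c\in\mathbb{A}^k$ for which there is a sequence $\{x_l\}_{l\in\mathbb{N}}\subset\mathbb{A}^n$ with $\|x_l\|\to\infty$, $F(x_l)\to c$ and $(1+\|x_l\|)\,\nu(dF(x_l))\to 0$, where $\nu(B)=\inf_{\|\varphi\|=1}\|B^*(\varphi)\|$ for a linear map $B$ with adjoint $B^*$ (for mixed maps, $dF$ is the real differential of the underlying real map). **Supports, convenience, Newton polyhedra.** For $f(x)=\sum_\nu c_\nu x^\nu$ put $\operatorname{supp}(f)=\{\nu\in\mathbb{N}^n: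 c_\nu\ne0\}$; for mixed $f(z,\bar z)=\sum_{\nu,\mu}c_{\nu,\mu}z^\nu\bar z^\mu$ put $\operatorname{supp}(f)=\{\nu+\mu: c_{\nu,\mu}\neq0\}$. When $f(0)=0$, $f$ is *convenient* if $\operatorname{supp}(f)$ meets every coordinate axis, and $\Gamma_0(f)$ is the convex hull of $\{0\}\cup\operatorname{supp}(f)$. For a face $\Delta$ (of any dimension), $f_\Delta=\sum_{\nu\in\Delta\cap\operatorname{supp}(f)}c_\nu x^\nu$, resp. $f_\Delta=\sum_{\nu+\mu\in\Delta\cap\operatorname{supp}(f)}c_{\nu,\mu}z^\nu\bar z^\mu$ in the mixed case. **Dual subdivision.** For $\mathbf{p}=(p_1,\ldots,p_n)\in\mathbb{Z}^n$ with $\min_i p_i<0$, let $l_{\mathbf{p}}(v)=\sum_i p_iv_i$ and let $\Delta^j_{\mathbf{p}}$ be the maximal face of $\Gamma_0(f_j)$ on which $l_{\mathbf{p}}$ attains its minimum over $\Gamma_0(f_j)$. Declare $\mathbf{p}\sim\mathbf{p}'$ iff $\Delta^j_{\mathbf{p}}=\Delta^j_{\mathbf{p}'}$ for all $1\le j\le k$. The equivalence classes give a partition of $\mathbb{R}^n\setminus\mathbb{R}^n_+$ (where $\mathbb{R}_+^n$ is the set of vectors with all coordinates $\ge 0$) into finitely many locally closed cones; each is subdivided into finitely many convex polyhedral cones, and $\mathcal{C}(F)$ is the finite set of cones obtained. For $\sigma\in\mathcal{C}(F)$, write $\Delta^j_\sigma:=\Delta^j_{\mathbf{p}}$ for any $\mathbf{p}\in\sigma$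 (independent of $\mathbf{p}$), and $$I_\sigma=\{j: 0\notin\Delta^j_\sigma\},\quad J_\sigma=\{j:\Delta^j_\sigma=\{0\}\},$$ $$G_\sigma=\{x\in(\mathbb{A}^* )^n: f_{\Delta^j_\sigma}(x)=0\ \text{for all } j\in I_\sigma\},$$ where $f_{\Delta^j_\sigma}$ stands for $(f_j)_{\Delta^j_\sigma}$. **Non-degeneracy at infinity.** $F$ (with $F(0)=0$) is *non-degenerate at infinity* if for every $\sigma\in\mathcal{C}(F)$ with $I_\sigma\neq\emptyset$ and $J_\sigma=\emptyset$, one has $\operatorname{Sing}\,(f_{\Delta^j_\sigma})_{j\in I_\sigma}\cap G_\sigma=\emptyset$. *)

theory Defs
  imports "HOL-Analysis.Analysis" "HOL-Library.Poly_Mapping" "HOL-Library.Disjoint_Sets"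
begin

section \<open>Polynomials and polynomial mappings\<close>

text \<open>
  A polynomial in variables indexed by the finite type \<open>'n\<close> is its finitely supported family
  of coefficients; in a mixed polynomial the key \<open>(\<nu>, \<mu>)\<close> carries the coefficient of
  \<open>z^\<nu> * cnj z^\<mu>\<close>.
\<close>

type_synonym ('a, 'n) polyn = "(nat ^ 'n) \<Rightarrow>\<^sub>0 'a"

type_synonym 'n mixed_polyn = "((nat ^ 'n) \<times> (nat ^ 'n)) \<Rightarrow>\<^sub>0 complex"

definition monomial :: "'a::comm_semiring_1 ^ 'n::finite \<Rightarrow> nat ^ 'n \<Rightarrow> 'a" where
  "monomial x \<nu> = (\<Prod>i\<in>UNIV. (x $ i) ^ (\<nu> $ i))"

definition vec_cnj :: "complex ^ 'n \<Rightarrow> complex ^ 'n::finite" where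
  "vec_cnj z = (\<chi> i. cnj (z $ i))"

definition lattice_point :: "nat ^ 'n \<Rightarrow> real ^ 'n::finite" where
  "lattice_point \<nu> = (\<chi> i. real (\<nu> $ i))"

definition poly_supp :: "('a::comm_ring_1, 'n::finite) polyn \<Rightarrow> (real ^ 'n) set" where
  "poly_supp f = lattice_point ` Poly_Mapping.keys f"

definition poly_eval :: "('a::comm_ring_1, 'n::finite) polyn \<Rightarrow> 'a ^ 'n \<Rightarrow> 'a" where
  "poly_eval f x = (\<Sum>\<nu>\<in>Poly_Mapping.keys f. Poly_Mapping.lookup f \<nu> * monomial x \<nu>)"

definition poly_face ::
  "('a::comm_ring_1, 'n::finite) polyn \<Rightarrow> (real ^ 'n) set \<Rightarrow> 'a ^ 'n \<Rightarrow> 'a" where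
  "poly_face f \<Delta> x =
     (\<Sum>\<nu>\<in>{\<nu>\<in>Poly_Mapping.keys f. lattice_point \<nu> \<in> \<Delta>}.
        Poly_Mapping.lookup f \<nu> * monomial x \<nu>)"

definition poly_map ::
  "('k \<Rightarrow> ('a::comm_ring_1, 'n::finite) polyn) \<Rightarrow> 'a ^ 'n \<Rightarrow> 'a ^ 'k::finite" where
  "poly_map P x = (\<chi> j. poly_eval (P j) x)"

definition mixed_supp :: "'n::finite mixed_polyn \<Rightarrow> (real ^ 'n) set" where
  "mixed_supp f = (\<lambda>(\<nu>, \<mu>). lattice_point (\<nu> + \<mu>)) ` Poly_Mapping.keys f"

definition mixed_eval :: "'n::finite mixed_polyn \<Rightarrow> complex ^ 'n \<Rightarrow> complex" where
  "mixed_eval f z =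
     (\<Sum>(\<nu>, \<mu>)\<in>Poly_Mapping.keys f.
        Poly_Mapping.lookup f (\<nu>, \<mu>) * monomial z \<nu> * monomial (vec_cnj z) \<mu>)"

definition mixed_face ::
  "'n::finite mixed_polyn \<Rightarrow> (real ^ 'n) set \<Rightarrow> complex ^ 'n \<Rightarrow> complex" where
  "mixed_face f \<Delta> z =
     (\<Sum>(\<nu>, \<mu>)\<in>{(\<nu>, \<mu>)\<in>Poly_Mapping.keys f. lattice_point (\<nu> + \<mu>) \<in> \<Delta>}.
        Poly_Mapping.lookup f (\<nu>, \<mu>) * monomial z \<nu> * monomial (vec_cnj z) \<mu>)"

definition mixed_map ::
  "('k \<Rightarrow> 'n::finite mixed_polyn) \<Rightarrow> complex ^ 'n \<Rightarrow> complex ^ 'k::finite" where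
  "mixed_map M z = (\<chi> j. mixed_eval (M j) z)"


section \<open>Asymptotic critical values\<close>

text \<open>
  All differentials are Frechet derivatives over the reals. For a complex polynomial map this
  is the complex differential regarded as a real linear map; its adjoint for the real inner
  product of \<open>complex ^ 'n\<close> is the Hermitian adjoint, because that inner product is the real
  part of the Hermitian one. Hence the following notions serve the real, the complex and the
  mixed case at once.
\<close>

definition rabier :: "('a::euclidean_space \<Rightarrow> 'b::euclidean_space) \<Rightarrow> real" where
  "rabier B = (INF \<phi>\<in>{\<phi>. norm \<phi> = 1}. norm (adjoint B \<phi>))"

definition K_infinity :: "('a::euclidean_space \<Rightarrow> 'b::euclidean_space) \<Rightarrow> 'b set" where
  "K_infinity F =
     {c. \<exists>x :: nat \<Rightarrow> 'a.
        filterlim (\<lambda>l. norm (x l)) at_top sequentially \<and>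
        (\<lambda>l. F (x l)) \<longlonglongrightarrow> c \<and>
        (\<lambda>l. (1 + norm (x l)) * rabier (frechet_derivative F (at (x l)))) \<longlonglongrightarrow> 0}"


section \<open>Newton polyhedra and the dual subdivision\<close>

text \<open>
  These notions depend on a polynomial only through its support \<open>S\<close>.
\<close>

definition convenient :: "(real ^ 'n::finite) set \<Rightarrow> bool" where
  "convenient S \<longleftrightarrow> (\<forall>i. S \<inter> range (axis i) \<noteq> {})"

definition newton_polyhedron :: "(real ^ 'n::finite) set \<Rightarrow> (real ^ 'n) set" where
  "newton_polyhedron S = convex hull (insert 0 S)"

definition min_face :: "(real ^ 'n::finite) set \<Rightarrow> real ^ 'n \<Rightarrow> (real ^ 'n) set" where
  "min_face S p = {v \<in> newton_polyhedron S. \<forall>w\<in>newton_polyhedron S. p \<bullet> v \<le> p \<bullet> w}"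

definition dual_domain :: "(real ^ 'n::finite) set" where
  "dual_domain = UNIV - {p. \<forall>i. 0 \<le> p $ i}"

definition dual_rel ::
  "('k \<Rightarrow> (real ^ 'n::finite) set) \<Rightarrow> ((real ^ 'n) \<times> (real ^ 'n)) set" where
  "dual_rel S =
     {(p, q). p \<in> dual_domain \<and> q \<in> dual_domain \<and> (\<forall>j. min_face (S j) p = min_face (S j) q)}"

text \<open>
  The cones of a dual subdivision form a partition, so they cannot all be closed: a cone is
  cut out by finitely many homogeneous weak and strict linear inequalities.
\<close>

definition convex_polyhedral_cone :: "(real ^ 'n::finite) set \<Rightarrow> bool" where
  "convex_polyhedral_cone \<sigma> \<longleftrightarrow>
     (\<exists>A B. finite A \<and> finite B \<and> \<sigma> = {p. (\<forall>a\<in>A. 0 \<le> a \<bullet> p) \<and> (\<forall>b\<in>B. 0 < b \<bullet> p)})"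

text \<open>
  The way the equivalence classes are cut into convex cones is not canonical, therefore being a
  dual subdivision is a property of a set of cones.
\<close>

definition dual_subdivision ::
  "('k \<Rightarrow> (real ^ 'n::finite) set) \<Rightarrow> (real ^ 'n) set set \<Rightarrow> bool" where
  "dual_subdivision S C \<longleftrightarrow>
     finite C \<and> (\<forall>\<sigma>\<in>C. convex_polyhedral_cone \<sigma>) \<and>
     refines dual_domain C (dual_domain // dual_rel S)"

text \<open>The choice of the point of \<open>\<sigma>\<close> is immaterial, see \<open>cone_face_eq\<close> below.\<close>

definition cone_face ::
  "('k \<Rightarrow> (real ^ 'n::finite) set) \<Rightarrow> (real ^ 'n) set \<Rightarrow> 'k \<Rightarrow> (real ^ 'n) set" where
  "cone_face S \<sigma> j = min_face (S j) (SOME p. p \<in> \<sigma>)"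

definition cone_I :: "('k \<Rightarrow> (real ^ 'n::finite) set) \<Rightarrow> (real ^ 'n) set \<Rightarrow> 'k set" where
  "cone_I S \<sigma> = {j. 0 \<notin> cone_face S \<sigma> j}"

definition cone_J :: "('k \<Rightarrow> (real ^ 'n::finite) set) \<Rightarrow> (real ^ 'n) set \<Rightarrow> 'k set" where
  "cone_J S \<sigma> = {j. cone_face S \<sigma> j = {0}}"


section \<open>Non-degeneracy at infinity\<close>

text \<open>
  \<open>sing I g\<close> is the singular set of the map with components \<open>g j\<close>, \<open>j \<in> I\<close>. Its target, the
  power of \<open>'a\<close> with exponent \<open>I\<close>, is realised as the coordinate subspace of \<open>'a ^ 'k\<close> of
  vectors vanishing outside \<open>I\<close>.
\<close>

definition sing ::
  "'k::finite set \<Rightarrow> ('k \<Rightarrow> 'a ^ 'n \<Rightarrow> 'a) \<Rightarrow> ('a::euclidean_space ^ 'n::finite) set" where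
  "sing I g =
     {x. range (frechet_derivative (\<lambda>y. (\<chi> j. if j \<in> I then g j y else 0) :: 'a ^ 'k) (at x))
           \<noteq> {w. \<forall>j. j \<notin> I \<longrightarrow> w $ j = 0}}"

text \<open>
  Here \<open>S j\<close> is the support of the component \<open>f j\<close>, and \<open>fc j \<Delta>\<close> is its truncation to the
  face \<open>\<Delta>\<close>.
\<close>

definition face_zeros ::
  "('k \<Rightarrow> (real ^ 'n) set) \<Rightarrow> ('k \<Rightarrow> (real ^ 'n) set \<Rightarrow> 'a ^ 'n \<Rightarrow> 'a) \<Rightarrow>
   (real ^ 'n) set \<Rightarrow> ('a::euclidean_space ^ 'n::finite) set" where
  "face_zeros S fc \<sigma> =
     {x. (\<forall>i. x $ i \<noteq> 0) \<and> (\<forall>j\<in>cone_I S \<sigma>. fc j (cone_face S \<sigma> j) x = 0)}"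

definition nondegenerate ::
  "(real ^ 'n) set set \<Rightarrow> ('k::finite \<Rightarrow> (real ^ 'n) set) \<Rightarrow>
   ('k \<Rightarrow> (real ^ 'n) set \<Rightarrow> 'a::euclidean_space ^ 'n::finite \<Rightarrow> 'a) \<Rightarrow> bool" where
  "nondegenerate C S fc \<longleftrightarrow>
     (\<forall>\<sigma>\<in>C. cone_I S \<sigma> \<noteq> {} \<and> cone_J S \<sigma> = {} \<longrightarrow>
        sing (cone_I S \<sigma>) (\<lambda>j. fc j (cone_face S \<sigma> j)) \<inter> face_zeros S fc \<sigma> = {})"

definition poly_nondegenerate_at_infinity ::
  "(real ^ 'n) set set \<Rightarrow> ('k::finite \<Rightarrow> ('a::{comm_ring_1, euclidean_space}, 'n::finite) polyn) \<Rightarrow>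
   bool" where
  "poly_nondegenerate_at_infinity C P \<longleftrightarrow>
     nondegenerate C (\<lambda>j. poly_supp (P j)) (\<lambda>j. poly_face (P j))"

definition mixed_nondegenerate_at_infinity ::
  "(real ^ 'n) set set \<Rightarrow> ('k::finite \<Rightarrow> 'n::finite mixed_polyn) \<Rightarrow> bool" where
  "mixed_nondegenerate_at_infinity C M \<longleftrightarrow>
     nondegenerate C (\<lambda>j. mixed_supp (M j)) (\<lambda>j. mixed_face (M j))"


section \<open>Well-definedness and existence of dual subdivisions\<close>

lemma equiv_dual_rel: "equiv dual_domain (dual_rel S)"
  by (rule equivI) (auto simp: dual_rel_def refl_on_def sym_def trans_def)

lemma cone_face_eq:
  assumes "dual_subdivision S C" "\<sigma> \<in> C" "p \<in> \<sigma>"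
  shows "cone_face S \<sigma> j = min_face (S j) p"
proof -
  obtain Y where Y: "Y \<in> dual_domain // dual_rel S" "\<sigma> \<subseteq> Y"
    using assms by (auto simp: dual_subdivision_def refines_def)
  have "(SOME p. p \<in> \<sigma>) \<in> \<sigma>"
    using assms(3) by (rule someI)
  then have "(SOME p. p \<in> \<sigma>, p) \<in> dual_rel S"
    using Y assms(3) quotient_eq_iff[OF equiv_dual_rel Y(1) Y(1)] by blast
  then show ?thesis
    by (auto simp: dual_rel_def cone_face_def)
qed

lemma min_face_face_of: "min_face S p face_of newton_polyhedron S"
proof (cases "min_face S p = {}")
  case False
  then obtain v where v: "v \<in> newton_polyhedron S" "\<And>w. w \<in> newton_polyhedron S \<Longrightarrow> p \<bullet> v \<le> p \<bullet> w"
    by (auto simp: min_face_def)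
  have "min_face S p = newton_polyhedron S \<inter> {x. p \<bullet> x = p \<bullet> v}"
    using v by (force simp: min_face_def)
  then show ?thesis
    using face_of_Int_supporting_hyperplane_ge[where S = "newton_polyhedron S" and a = p and b = "p \<bullet> v"] v
    by (simp add: newton_polyhedron_def)
qed simp

lemma min_face_subset:
  assumes "finite S"
    and "\<And>v w. v \<in> insert 0 S \<Longrightarrow> w \<in> insert 0 S \<Longrightarrow> p \<bullet> v \<le> p \<bullet> w \<Longrightarrow> q \<bullet> v \<le> q \<bullet> w"
  shows "min_face S p \<subseteq> min_face S q"
proof -
  obtain T where T: "T \<subseteq> insert 0 S" "min_face S p = convex hull T"
    using face_of_convex_hull_subset[of "insert 0 S" "min_face S p"] min_face_face_of[of S p] assms(1)
    by (auto simp: newton_polyhedron_def finite_imp_compact)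
  have "T \<subseteq> min_face S q"
  proof
    fix v assume "v \<in> T"
    then have v: "v \<in> min_face S p" "v \<in> insert 0 S"
      using T hull_subset[of T convex] by auto
    have "q \<bullet> v \<le> q \<bullet> w" if "w \<in> insert 0 S" for w
    proof (rule assms(2)[OF v(2) that])
      show "p \<bullet> v \<le> p \<bullet> w"
        using v(1) hull_inc[OF that, of convex] by (auto simp: min_face_def newton_polyhedron_def)
    qed
    then have "insert 0 S \<subseteq> {w. q \<bullet> v \<le> q \<bullet> w}"
      by blast
    moreover have "convex {w. q \<bullet> v \<le> q \<bullet> w}"
      using convex_halfspace_ge[where a = q and b = "q \<bullet> v"] by simp
    ultimately have "convex hull (insert 0 S) \<subseteq> {w. q \<bullet> v \<le> q \<bullet> w}"
      by (rule hull_minimal)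
    then show "v \<in> min_face S q"
      using v(1) by (auto simp: min_face_def newton_polyhedron_def)
  qed
  then show ?thesis
    unfolding T(2) by (intro hull_minimal face_of_imp_convex[OF min_face_face_of])
qed

lemma dual_subdivision_exists:
  fixes S :: "'k::finite \<Rightarrow> (real ^ 'n::finite) set"
  assumes fin: "\<And>j. finite (S j)"
  shows "\<exists>C. dual_subdivision S C"
proof -
  define H where "H = (\<Union>j. (\<lambda>(v, w). v - w) ` (insert 0 (S j) \<times> insert 0 (S j))) \<union>
    range (\<lambda>i. axis i (1::real) :: real ^ 'n)"
  have finH: "finite H"
    using fin by (auto simp: H_def)
  define R where "R = {(p, q). p \<in> dual_domain \<and> (\<forall>h\<in>H. sgn (h \<bullet> q) = sgn (h \<bullet> p))}"
  have dom: "q \<in> dual_domain" if "(p, q) \<in> R" for p q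
  proof -
    obtain i where "p $ i < 0"
      using \<open>(p, q) \<in> R\<close> by (auto simp: R_def dual_domain_def not_le)
    moreover have "sgn (axis i 1 \<bullet> q) = sgn (axis i 1 \<bullet> p)"
      using \<open>(p, q) \<in> R\<close> unfolding R_def H_def by blast
    ultimately have "q $ i < 0"
      by (simp add: inner_axis inner_commute sgn_real_def split: if_splits)
    then show ?thesis
      by (auto simp: dual_domain_def not_le)
  qed
  have eqR: "equiv dual_domain R"
  proof (rule equivI)
    show "R \<subseteq> dual_domain \<times> dual_domain" using dom by (auto simp: R_def)
    show "refl_on dual_domain R" by (auto simp: refl_on_def R_def)
    show "sym R" using dom by (auto simp: sym_def R_def)
    show "trans R" by (auto simp: trans_def R_def)
  qed
  define g :: "(real ^ 'n) set \<times> (real ^ 'n) set \<Rightarrow> (real ^ 'n) set" where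
    "g = (\<lambda>(A, B). {q. (\<forall>a\<in>A. 0 \<le> a \<bullet> q) \<and> (\<forall>b\<in>B. 0 < b \<bullet> q)})"
  let ?A = "\<lambda>p. {h \<in> H \<union> uminus ` H. h \<bullet> p = 0}" and ?B = "\<lambda>p. {h \<in> H \<union> uminus ` H. 0 < h \<bullet> p}"
  have cls: "R `` {p} = g (?A p, ?B p)" if "p \<in> dual_domain" for p
  proof -
    have "(\<forall>h\<in>H. sgn (h \<bullet> q) = sgn (h \<bullet> p)) \<longleftrightarrow> q \<in> g (?A p, ?B p)" (is "?L \<longleftrightarrow> ?R") for q
    proof
      assume L: ?L
      have pos: "0 < h \<bullet> q \<longleftrightarrow> 0 < h \<bullet> p" "h \<bullet> q < 0 \<longleftrightarrow> h \<bullet> p < 0" if "h \<in> H" for h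
        using L that by (metis sgn_greater, metis sgn_less)
      have "0 \<le> h \<bullet> q" if "h \<in> ?A p" for h
        using that pos[of h] pos[of "- h"] by (force simp: not_less[symmetric])
      moreover have "0 < h \<bullet> q" if "h \<in> ?B p" for h
        using that pos[of h] pos[of "- h"] by force
      ultimately show ?R
        unfolding g_def by blast
    next
      assume q: ?R
      show ?L
      proof
        fix h assume h: "h \<in> H"
        consider "h \<bullet> p = 0" | "h \<bullet> p > 0" | "h \<bullet> p < 0" by linarith
        then show "sgn (h \<bullet> q) = sgn (h \<bullet> p)"
        proof cases
          case 1
          then have "h \<in> ?A p" "- h \<in> ?A p" using h by auto
          then have "0 \<le> h \<bullet> q" "0 \<le> - h \<bullet> q" using q unfolding g_def by blast+
          with 1 show ?thesis by simp
        next
          case 2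
          then have "h \<in> ?B p" using h by auto
          then have "0 < h \<bullet> q" using q unfolding g_def by blast
          with 2 show ?thesis by simp
        next
          case 3
          then have "- h \<in> ?B p" using h by auto
          then have "0 < - h \<bullet> q" using q unfolding g_def by blast
          with 3 show ?thesis by simp
        qed
      qed
    qed
    then show ?thesis using that by (auto simp: R_def)
  qed
  have finC: "finite (dual_domain // R)"
  proof (rule finite_subset)
    show "dual_domain // R \<subseteq> g ` (Pow (H \<union> uminus ` H) \<times> Pow (H \<union> uminus ` H))"
      using cls by (fastforce simp: quotient_def)
    show "finite (g ` (Pow (H \<union> uminus ` H) \<times> Pow (H \<union> uminus ` H)))"
      using finH by auto
  qed
  have cone: "convex_polyhedral_cone \<sigma>" if "\<sigma> \<in> dual_domain // R" for \<sigma>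
  proof -
    obtain p where p: "p \<in> dual_domain" "\<sigma> = R `` {p}"
      using \<open>\<sigma> \<in> dual_domain // R\<close> by (rule quotientE)
    show ?thesis
      unfolding convex_polyhedral_cone_def p(2) cls[OF p(1)]
      using finH by (intro exI[of _ "?A p"] exI[of _ "?B p"]) (auto simp: g_def)
  qed
  have sub: "min_face (S j) p \<subseteq> min_face (S j) q" if pq: "(p, q) \<in> R" for p q j
  proof (rule min_face_subset[OF fin])
    fix v w assume vw: "v \<in> insert 0 (S j)" "w \<in> insert 0 (S j)" and le: "p \<bullet> v \<le> p \<bullet> w"
    have "(\<lambda>(v, w). v - w) (w, v) \<in> H"
      unfolding H_def using vw by blast
    then have "sgn ((w - v) \<bullet> q) = sgn ((w - v) \<bullet> p)"
      using pq by (auto simp: R_def)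
    moreover have "0 \<le> (w - v) \<bullet> p"
      using le by (simp add: inner_diff_right inner_commute)
    ultimately have "0 \<le> (w - v) \<bullet> q"
      by (auto simp: sgn_real_def split: if_splits)
    then show "q \<bullet> v \<le> q \<bullet> w"
      by (simp add: inner_diff_right inner_commute)
  qed
  have RS: "R \<subseteq> dual_rel S"
  proof
    fix r assume r: "r \<in> R"
    obtain p q where pq: "r = (p, q)" by (cases r)
    have "(q, p) \<in> R" using r pq eqR by (auto simp: equiv_def sym_def)
    then show "r \<in> dual_rel S"
      using sub[of p q] sub[of q p] dom[of p q] dom[of q p] r pq
      by (auto simp: dual_rel_def)
  qed
  have "refines dual_domain (dual_domain // R) (dual_domain // dual_rel S)"
    unfolding refines_def
  proof (intro conjI ballI)
    show "partition_on dual_domain (dual_domain // R)"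
      by (rule partition_on_quotient[OF eqR])
    show "partition_on dual_domain (dual_domain // dual_rel S)"
      by (rule partition_on_quotient[OF equiv_dual_rel])
    fix X assume "X \<in> dual_domain // R"
    then obtain p where "p \<in> dual_domain" "X = R `` {p}"
      by (rule quotientE)
    then show "\<exists>Y\<in>dual_domain // dual_rel S. X \<subseteq> Y"
      using RS by (intro bexI[of _ "dual_rel S `` {p}"] quotientI) auto
  qed
  with finC cone show ?thesis
    unfolding dual_subdivision_def by blast
qed

end

theory Submission
  imports Defs
begin

text \<open>
  Take a sequence \<open>x l\<close> showing that a point lies in \<open>K_infinity F\<close>, with unit covectors \<open>\<phi> l\<close>
  almost realising the Rabier number; by continuity it may be moved off the coordinate
  hyperplanes. After passing to a subsequence, \<open>x l = exp (- p l) \<cdot> y l\<close> with \<open>y l\<close> converging to a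
  point \<open>a\<close> of the torus, while every difference of exponents is either orthogonal to all \<open>p l\<close> or
  has unbounded pairing with \<open>p l\<close>. Then \<open>p l\<close> eventually selects fixed faces \<open>\<Delta> j\<close>, which avoid
  \<open>0\<close> by convenience. Boundedness of \<open>f j (x l)\<close> forces the truncations to \<open>\<Delta> j\<close> to vanish at \<open>a\<close>.
  Rescaling the components of \<open>\<phi> l\<close> by the sizes of the leading monomials gives in the limit a
  nonzero covector that annihilates the differential of the truncated map at \<open>a\<close>, against
  nondegeneracy.
\<close>

section \<open>Rescaling sequences of exponents\<close>

lemma subseq_tendsto_ereal_finite:
  fixes u :: "nat \<Rightarrow> 'd \<Rightarrow> real"
  assumes "finite D"
  shows "\<exists>r. strict_mono r \<and> (\<forall>d\<in>D. \<exists>L. (\<lambda>l. ereal (u (r l) d)) \<longlonglongrightarrow> L)"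
  using assms
proof (induction D rule: finite_induct)
  case empty
  show ?case by (rule exI[of _ id]) (simp add: strict_mono_def)
next
  case (insert d D)
  then obtain r where r: "strict_mono r" "\<And>d. d \<in> D \<Longrightarrow> \<exists>L. (\<lambda>l. ereal (u (r l) d)) \<longlonglongrightarrow> L"
    by blast
  obtain L s where s: "strict_mono s" "((\<lambda>l. ereal (u (r l) d)) \<circ> s) \<longlonglongrightarrow> L"
    using compact_complete_linorder[of "\<lambda>l. ereal (u (r l) d)"] by blast
  have "\<exists>L. (\<lambda>l. ereal (u ((r \<circ> s) l) e)) \<longlonglongrightarrow> L" if "e \<in> insert d D" for e
  proof (cases "e = d")
    case True
    then show ?thesis using s(2) by (auto simp: o_def)
  next
    case False
    with \<open>e \<in> insert d D\<close> obtain L where "(\<lambda>l. ereal (u (r l) e)) \<longlonglongrightarrow> L"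
      using r(2) by blast
    from LIMSEQ_subseq_LIMSEQ[OF this s(1)] show ?thesis by (auto simp: o_def)
  qed
  with strict_mono_o[OF r(1) s(1)] show ?case by blast
qed

text \<open>
  Directions along which \<open>u\<close> converges form a subspace; \<open>v\<close> is the projection of \<open>u\<close> onto it.
  This takes the place of the curve selection lemma: \<open>v l - u (r l)\<close> has the role of the
  exponent vector of a curve and \<open>exp (v l)\<close> that of its leading coefficients.
\<close>

lemma subseq_split_convergent_divergent:
  fixes u :: "nat \<Rightarrow> 'a::euclidean_space"
  assumes "finite D"
  obtains r v b where "strict_mono (r :: nat \<Rightarrow> nat)" "v \<longlonglongrightarrow> b"
    "\<forall>d\<in>D. (\<forall>l. (v l - u (r l)) \<bullet> d = 0) \<or>
       filterlim (\<lambda>l. (v l - u (r l)) \<bullet> d) at_top sequentially \<or>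
       filterlim (\<lambda>l. (v l - u (r l)) \<bullet> d) at_bot sequentially"
proof -
  obtain r where r: "strict_mono r"
    and lim: "\<And>d. d \<in> D \<Longrightarrow> \<exists>L. (\<lambda>l. ereal (u (r l) \<bullet> d)) \<longlonglongrightarrow> L"
    using subseq_tendsto_ereal_finite[OF assms, of "\<lambda>l d. u l \<bullet> d"] by blast
  define V where "V = {d. convergent (\<lambda>l. u (r l) \<bullet> d)}"
  have "subspace V"
  proof (rule subspaceI)
    show "0 \<in> V" by (simp add: V_def convergent_const)
    show "x + y \<in> V" if "x \<in> V" "y \<in> V" for x y
      using that by (simp add: V_def inner_add_right convergent_add)
    show "c *\<^sub>R x \<in> V" if "x \<in> V" for c x
      using that unfolding V_def convergent_def inner_scaleR_right mem_Collect_eq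
      by (blast dest: tendsto_mult_left[where c = c])
  qed
  then have "\<exists>B. B \<subseteq> V \<and> pairwise orthogonal B \<and> (\<forall>x\<in>B. norm x = 1) \<and> independent B \<and> span B = V"
    by (rule orthonormal_basis_subspace) blast
  then obtain B where B: "B \<subseteq> V" "pairwise orthogonal B" "\<And>x. x \<in> B \<Longrightarrow> norm x = 1"
      "independent B" "span B = V"
    by blast
  have "finite B" using B(4) by (rule independent_imp_finite)
  define L where "L e = lim (\<lambda>l. u (r l) \<bullet> e)" for e
  have L: "(\<lambda>l. u (r l) \<bullet> e) \<longlonglongrightarrow> L e" if "e \<in> B" for e
    using B(1) that by (auto simp: V_def L_def convergent_LIMSEQ_iff)
  define v where "v = (\<lambda>l. \<Sum>e\<in>B. (u (r l) \<bullet> e) *\<^sub>R e)"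
  have v: "v \<longlonglongrightarrow> (\<Sum>e\<in>B. L e *\<^sub>R e)"
    unfolding v_def by (intro tendsto_intros L)
  have "(v l - u (r l)) \<bullet> e = 0" if "e \<in> B" for l e
  proof -
    have "v l \<bullet> e = (\<Sum>e'\<in>B. if e' = e then u (r l) \<bullet> e else 0)"
      unfolding v_def inner_sum_left
    proof (rule sum.cong)
      fix e' assume "e' \<in> B"
      then show "(u (r l) \<bullet> e') *\<^sub>R e' \<bullet> e = (if e' = e then u (r l) \<bullet> e else 0)"
        using B(2,3) that by (auto simp: pairwise_def orthogonal_def dot_square_norm)
    qed simp
    then show ?thesis using \<open>finite B\<close> that by (simp add: inner_diff_left)
  qed
  then have "orthogonal (v l - u (r l)) d" if "d \<in> V" for l d
    using orthogonal_to_span[of d B] that B(5) by (auto simp: orthogonal_def)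
  then have orth: "(v l - u (r l)) \<bullet> d = 0" if "d \<in> V" for l d
    using that by (simp add: orthogonal_def)
  have "(\<forall>l. (v l - u (r l)) \<bullet> d = 0) \<or>
       filterlim (\<lambda>l. (v l - u (r l)) \<bullet> d) at_top sequentially \<or>
       filterlim (\<lambda>l. (v l - u (r l)) \<bullet> d) at_bot sequentially" if "d \<in> D" for d
  proof -
    have vd: "(\<lambda>l. v l \<bullet> d) \<longlonglongrightarrow> (\<Sum>e\<in>B. L e *\<^sub>R e) \<bullet> d"
      by (intro tendsto_intros v)
    obtain L' where L': "(\<lambda>l. ereal (u (r l) \<bullet> d)) \<longlonglongrightarrow> L'"
      using lim \<open>d \<in> D\<close> by blast
    \<comment> \<open>An infinite limit of \<open>u (r l) \<bullet> d\<close> cannot be cancelled by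
      the convergent \<open>v l \<bullet> d\<close>. The sign flips because \<open>u\<close> enters
      negatively.\<close>
    show ?thesis
    proof (cases L')
      case (real x)
      then have "d \<in> V" using L' by (auto simp: V_def convergent_def)
      then show ?thesis using orth by blast
    next
      case PInf
      then have "filterlim (\<lambda>l. u (r l) \<bullet> d) at_top sequentially"
        using L' by (auto simp: tendsto_PInfty filterlim_at_top_dense)
      then have "filterlim (\<lambda>l. - (v l \<bullet> d) + u (r l) \<bullet> d) at_top sequentially"
        by (rule filterlim_tendsto_add_at_top[OF tendsto_minus[OF vd]])
      then show ?thesis by (simp add: inner_diff_left filterlim_uminus_at_bot)
    next
      case MInf
      then have "filterlim (\<lambda>l. u (r l) \<bullet> d) at_bot sequentially"
        using L' by (auto simp: tendsto_MInfty filterlim_at_bot_dense)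
      then have "filterlim (\<lambda>l. v l \<bullet> d + - (u (r l) \<bullet> d)) at_top sequentially"
        by (intro filterlim_tendsto_add_at_top[OF vd]) (simp add: filterlim_uminus_at_top)
      then show ?thesis by (simp add: inner_diff_left)
    qed
  qed
  with r v that show ?thesis by blast
qed


section \<open>Continuously differentiable maps\<close>

text \<open>On Euclidean spaces, continuity of the derivative in each fixed direction amounts to
  continuity in operator norm; this form spares the type of bounded linear maps.\<close>

definition C1_with :: "('a::real_normed_vector \<Rightarrow> 'b::real_normed_vector) \<Rightarrow> ('a \<Rightarrow> 'a \<Rightarrow> 'b) \<Rightarrow> bool"
  where "C1_with f f' \<longleftrightarrow>
    (\<forall>x. (f has_derivative f' x) (at x)) \<and> (\<forall>h. continuous_on UNIV (\<lambda>x. f' x h))"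

lemma C1_with_continuous: "C1_with f f' \<Longrightarrow> continuous_on UNIV f"
  unfolding C1_with_def
  by (intro continuous_at_imp_continuous_on ballI) (blast intro: has_derivative_continuous)

lemma C1_with_const: "C1_with (\<lambda>x. c) (\<lambda>x h. 0)"
  by (auto simp: C1_with_def)

lemma C1_with_bounded_linear: "bounded_linear f \<Longrightarrow> C1_with f (\<lambda>x. f)"
  by (auto simp: C1_with_def bounded_linear_imp_has_derivative)

lemma C1_with_mult:
  fixes f g :: "'a::real_normed_vector \<Rightarrow> 'b::real_normed_algebra"
  assumes "C1_with f f'" "C1_with g g'"
  shows "C1_with (\<lambda>x. f x * g x) (\<lambda>x h. f x * g' x h + f' x h * g x)"
  using assms C1_with_continuous[OF assms(1)] C1_with_continuous[OF assms(2)]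
  by (auto simp: C1_with_def intro!: continuous_intros has_derivative_mult)

lemma C1_with_sum:
  assumes "\<And>k. k \<in> K \<Longrightarrow> C1_with (f k) (f' k)"
  shows "C1_with (\<lambda>x. \<Sum>k\<in>K. f k x) (\<lambda>x h. \<Sum>k\<in>K. f' k x h)"
  using assms by (auto simp: C1_with_def intro!: continuous_intros has_derivative_sum)

lemma C1_with_vec_lambda:
  fixes f :: "'a::real_normed_vector \<Rightarrow> 'k::finite \<Rightarrow> 'b::euclidean_space"
  assumes "\<And>j. C1_with (\<lambda>x. f x j) (f' j)"
  shows "C1_with (\<lambda>x. \<chi> j. f x j) (\<lambda>x h. \<chi> j. f' j x h)"
proof -
  have "((\<lambda>x. \<chi> j. f x j) has_derivative (\<lambda>h. \<chi> j. f' j x h)) (at x)" for x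
    using assms
    by (subst has_derivative_componentwise_within)
       (auto simp: C1_with_def Basis_vec_def inner_axis intro!: has_derivative_inner_left)
  then show ?thesis
    using assms by (auto simp: C1_with_def intro!: continuous_intros)
qed

lemma C1_with_prod:
  fixes f :: "'i \<Rightarrow> 'a::real_normed_vector \<Rightarrow> 'b::real_normed_field"
  assumes "\<And>i. i \<in> I \<Longrightarrow> \<exists>f'. C1_with (f i) f'"
  shows "\<exists>f'. C1_with (\<lambda>x. \<Prod>i\<in>I. f i x) f'"
  using assms
proof (induction I rule: infinite_finite_induct)
  case (insert i I)
  then obtain f' g' where "C1_with (f i) f'" "C1_with (\<lambda>x. \<Prod>i\<in>I. f i x) g'"
    by blast
  then show ?case
    using C1_with_mult insert by fastforce
qed (auto intro: C1_with_const)


section \<open>Perturbing an asymptotic critical sequence off the coordinate hyperplanes\<close>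

text \<open>All coordinates are shifted by the same \<open>\<delta> *\<^sub>R b\<close> with
  \<open>b \<noteq> 0\<close>. Each one vanishes for at most one \<open>\<delta>\<close>, so all
  small positive \<open>\<delta>\<close> avoid the finitely many bad values.\<close>

lemma eventually_nhds_imp_ex_nonzero_coordinates:
  fixes x :: "'a::euclidean_space ^ 'n::finite"
  assumes "eventually P (nhds x)"
  shows "\<exists>y. P y \<and> (\<forall>i. y $ i \<noteq> 0)"
proof -
  obtain b :: 'a where "b \<in> Basis" using nonempty_Basis by blast
  then have b: "b \<noteq> 0" using nonzero_Basis by blast
  define y where "y \<delta> = (\<chi> i. x $ i + \<delta> *\<^sub>R b)" for \<delta>
  have "((\<lambda>\<delta>. \<chi> i. x $ i + \<delta> *\<^sub>R b) \<longlongrightarrow> (\<chi> i. x $ i + 0 *\<^sub>R b)) (at_right 0)"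
    by (intro tendsto_intros)
  then have "(y \<longlongrightarrow> x) (at_right 0)"
    by (simp add: y_def[abs_def])
  then have "eventually (\<lambda>\<delta>. P (y \<delta>)) (at_right 0)"
    using assms by (rule eventually_compose_filterlim[rotated])
  moreover have "eventually (\<lambda>\<delta>. y \<delta> $ i \<noteq> 0) (at_right 0)" for i
  proof (cases "\<exists>\<delta>>0. y \<delta> $ i = 0")
    case True
    then obtain \<delta> where \<delta>: "\<delta> > 0" "x $ i + \<delta> *\<^sub>R b = 0" by (auto simp: y_def)
    have "y \<epsilon> $ i \<noteq> 0" if "\<epsilon> < \<delta>" for \<epsilon>
    proof
      assume "y \<epsilon> $ i = 0"
      then have "x $ i + \<delta> *\<^sub>R b = x $ i + \<epsilon> *\<^sub>R b" using \<delta>(2) by (simp add: y_def)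
      then show False using b that by simp
    qed
    then show ?thesis using \<delta>(1) by (auto simp: eventually_at_right_field)
  next
    case False
    then show ?thesis by (auto simp: eventually_at_right_field intro: exI[of _ 1])
  qed
  then have "eventually (\<lambda>\<delta>. \<forall>i. y \<delta> $ i \<noteq> 0) (at_right 0)"
    by (rule eventually_all_finite)
  ultimately have "eventually (\<lambda>\<delta>. P (y \<delta>) \<and> (\<forall>i. y \<delta> $ i \<noteq> 0)) (at_right (0::real))"
    by (rule eventually_conj)
  then show ?thesis
    using eventually_happens'[OF trivial_limit_at_right_real] by blast
qed

text \<open>In the standard basis the coordinates of the adjoint are
  \<open>F' x b \<bullet> \<phi>\<close>, continuous in \<open>x\<close> by assumption.\<close>

lemma continuous_on_adjoint:
  fixes F' :: "'a::euclidean_space \<Rightarrow> 'a \<Rightarrow> 'b::euclidean_space"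
  assumes "\<And>x. linear (F' x)" "\<And>h. continuous_on UNIV (\<lambda>x. F' x h)"
  shows "continuous_on UNIV (\<lambda>x. adjoint (F' x) \<phi>)"
proof -
  have "adjoint (F' x) \<phi> = (\<Sum>b\<in>Basis. (F' x b \<bullet> \<phi>) *\<^sub>R b)" for x
    using euclidean_representation[of "adjoint (F' x) \<phi>"] adjoint_works[OF assms(1)]
    by (simp add: inner_commute)
  then show ?thesis
    by (auto intro!: continuous_intros assms)
qed

text \<open>An almost minimising covector \<open>\<phi> l\<close> replaces the infimum in
  \<open>rabier\<close>. With \<open>\<phi> l\<close> fixed, all quantities involved are continuous
  in the point, so \<open>x l\<close> can be moved slightly into the torus.\<close>

lemma K_infinity_sequence:
  fixes F :: "'a::euclidean_space ^ 'n::finite \<Rightarrow> 'b::euclidean_space"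
  assumes C1: "C1_with F F'" and c: "c \<in> K_infinity F"
  obtains x \<phi> where "\<And>l i. x l $ i \<noteq> 0" "filterlim (\<lambda>l. norm (x l)) at_top sequentially"
    "(\<lambda>l. F (x l)) \<longlonglongrightarrow> c" "\<And>l. norm (\<phi> l) = 1"
    "(\<lambda>l. (1 + norm (x l)) * norm (adjoint (F' (x l)) (\<phi> l))) \<longlonglongrightarrow> 0"
proof -
  have der: "frechet_derivative F (at x) = F' x" for x
    using C1 frechet_derivative_at by (metis C1_with_def)
  have lin: "linear (F' x)" for x
    using C1 by (auto simp: C1_with_def dest: has_derivative_linear)
  obtain x where x: "filterlim (\<lambda>l. norm (x l)) at_top sequentially" "(\<lambda>l. F (x l)) \<longlonglongrightarrow> c"
    "(\<lambda>l. (1 + norm (x l)) * rabier (F' (x l))) \<longlonglongrightarrow> 0"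
    using c by (auto simp: K_infinity_def der)
  define \<epsilon> :: "nat \<Rightarrow> real" where "\<epsilon> l = inverse (real (Suc l))" for l
  have \<epsilon>: "\<epsilon> \<longlonglongrightarrow> 0" "\<And>l. \<epsilon> l > 0"
    unfolding \<epsilon>_def[abs_def] by (rule LIMSEQ_inverse_real_of_nat) simp
  have "\<exists>\<phi>. norm \<phi> = 1 \<and> (1 + norm (x l)) * norm (adjoint (F' (x l)) \<phi>)
      < (1 + norm (x l)) * rabier (F' (x l)) + \<epsilon> l" for l
  proof -
    have pos: "1 + norm (x l) > 0" by (simp add: add_pos_nonneg)
    have ne: "{\<phi> :: 'b. norm \<phi> = 1} \<noteq> {}"
      using vector_choose_size[of 1] by auto
    \<comment> \<open>The error is divided by the weight so that it becomes
      \<open>\<epsilon> l\<close> after multiplication by \<open>1 + norm (x l)\<close>.\<close>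
    have "rabier (F' (x l)) < rabier (F' (x l)) + \<epsilon> l / (1 + norm (x l))"
      using \<epsilon>(2) pos by simp
    then obtain \<phi> where "norm \<phi> = 1"
        "norm (adjoint (F' (x l)) \<phi>) < rabier (F' (x l)) + \<epsilon> l / (1 + norm (x l))"
      unfolding rabier_def by (subst (asm) cINF_less_iff[OF ne]) (auto intro: bdd_belowI2[of _ 0])
    then show ?thesis
      using pos by (intro exI[of _ \<phi>]) (auto simp: field_simps)
  qed
  then obtain \<phi> where \<phi>: "\<And>l. norm (\<phi> l) = 1"
    "\<And>l. (1 + norm (x l)) * norm (adjoint (F' (x l)) (\<phi> l))
      < (1 + norm (x l)) * rabier (F' (x l)) + \<epsilon> l"
    by metis
  define G where "G l y = (1 + norm y) * norm (adjoint (F' y) (\<phi> l))" for l y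
  have contG: "continuous_on UNIV (G l)" for l
    unfolding G_def[abs_def] using C1
    by (intro continuous_intros continuous_on_adjoint lin) (auto simp: C1_with_def)
  have "\<exists>y. (norm (x l) - 1 < norm y \<and> dist (F y) (F (x l)) < \<epsilon> l \<and>
      G l y < (1 + norm (x l)) * rabier (F' (x l)) + \<epsilon> l) \<and> (\<forall>i. y $ i \<noteq> 0)" for l
  proof (rule eventually_nhds_imp_ex_nonzero_coordinates, intro eventually_conj)
    have lim: "(f \<longlongrightarrow> f (x l)) (nhds (x l))"
      if "continuous_on UNIV f" for f :: "'a ^ 'n \<Rightarrow> 'z::topological_space"
      using that by (simp add: continuous_on_eq_continuous_at isCont_def tendsto_at_iff_tendsto_nhds)
    show "eventually (\<lambda>y. norm (x l) - 1 < norm y) (nhds (x l))"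
      using lim[of norm] by (rule order_tendstoD) (auto intro: continuous_intros)
    show "eventually (\<lambda>y. dist (F y) (F (x l)) < \<epsilon> l) (nhds (x l))"
      using lim[OF C1_with_continuous[OF C1]] \<epsilon>(2) by (rule tendstoD)
    show "eventually (\<lambda>y. G l y < (1 + norm (x l)) * rabier (F' (x l)) + \<epsilon> l) (nhds (x l))"
      using lim[OF contG[of l]] by (rule order_tendstoD) (use \<phi>(2) in \<open>simp add: G_def\<close>)
  qed
  then obtain y where y: "\<And>l. norm (x l) - 1 < norm (y l)" "\<And>l. dist (F (y l)) (F (x l)) < \<epsilon> l"
      "\<And>l. G l (y l) < (1 + norm (x l)) * rabier (F' (x l)) + \<epsilon> l" "\<And>l i. y l $ i \<noteq> 0"
    by metis
  show thesis
  proof (rule that)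
    show "y l $ i \<noteq> 0" for l i by (rule y)
    show "norm (\<phi> l) = 1" for l by (rule \<phi>)
    have "filterlim (\<lambda>l. -1 + norm (x l)) at_top sequentially"
      by (rule filterlim_tendsto_add_at_top[OF tendsto_const x(1)])
    then show "filterlim (\<lambda>l. norm (y l)) at_top sequentially"
      by (rule filterlim_at_top_mono) (auto intro!: always_eventually less_imp_le simp: y(1) add.commute)
    have "(\<lambda>l. dist (F (y l)) (F (x l))) \<longlonglongrightarrow> 0"
      by (rule tendsto_sandwich[OF _ _ tendsto_const \<epsilon>(1)])
         (auto intro!: always_eventually less_imp_le y(2))
    then have "(\<lambda>l. (F (y l) - F (x l)) + F (x l)) \<longlonglongrightarrow> 0 + c"
      by (intro tendsto_add x(2)) (simp add: dist_norm tendsto_norm_zero_iff)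
    then show "(\<lambda>l. F (y l)) \<longlonglongrightarrow> c" by simp
    show "(\<lambda>l. (1 + norm (y l)) * norm (adjoint (F' (y l)) (\<phi> l))) \<longlonglongrightarrow> 0"
      unfolding G_def[symmetric]
    proof (rule tendsto_sandwich[OF _ _ tendsto_const])
      show "(\<lambda>l. (1 + norm (x l)) * rabier (F' (x l)) + \<epsilon> l) \<longlonglongrightarrow> 0"
        using tendsto_add[OF x(3) \<epsilon>(1)] by simp
      show "eventually (\<lambda>l. G l (y l) \<le> (1 + norm (x l)) * rabier (F' (x l)) + \<epsilon> l) sequentially"
        by (intro always_eventually allI less_imp_le y(3))
      show "eventually (\<lambda>l. 0 \<le> G l (y l)) sequentially"
        by (auto simp: G_def intro!: always_eventually)
    qed
  qed
qed

section \<open>Scaling by the real torus\<close>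

text \<open>Positive diagonal matrices in logarithmic coordinates: a monomial with exponent
  \<open>e\<close> gets the factor \<open>exp (s \<bullet> e)\<close>. Real factors commute with
  complex conjugation, so mixed monomials scale likewise.\<close>

definition torus_scale :: "real ^ 'n \<Rightarrow> 'a::real_vector ^ 'n \<Rightarrow> 'a ^ 'n::finite" where
  "torus_scale s x = (\<chi> i. exp (s $ i) *\<^sub>R x $ i)"

lemma bounded_linear_torus_scale:
  "bounded_linear (torus_scale s :: 'a::euclidean_space ^ 'n \<Rightarrow> 'a ^ 'n::finite)"
  by (intro linear_conv_bounded_linear[THEN iffD1] linearI)
     (auto simp: torus_scale_def vec_eq_iff scaleR_add_right)

text \<open>Differentiate the homogeneity relation in \<open>x\<close> by the chain rule. The
  direction is scaled together with the point, which keeps the weight \<open>e\<close>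
  unchanged.\<close>

lemma quasihomogeneous_derivative:
  fixes T :: "'a::euclidean_space ^ 'n::finite \<Rightarrow> 'b::real_normed_vector"
  assumes C1: "C1_with T T'" and hom: "\<And>s x. T (torus_scale s x) = exp (s \<bullet> e) *\<^sub>R T x"
  shows "T' (torus_scale s x) (torus_scale s h) = exp (s \<bullet> e) *\<^sub>R T' x h"
proof -
  have "((\<lambda>x. T (torus_scale s x)) has_derivative (\<lambda>h. T' (torus_scale s x) (torus_scale s h))) (at x)"
    using C1 unfolding C1_with_def
    by (intro has_derivative_compose[OF bounded_linear_imp_has_derivative[OF bounded_linear_torus_scale]]) blast
  moreover have "((\<lambda>x. T (torus_scale s x)) has_derivative (\<lambda>h. exp (s \<bullet> e) *\<^sub>R T' x h)) (at x)"
    unfolding hom using C1 by (auto simp: C1_with_def intro!: has_derivative_scaleR_right)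
  ultimately show ?thesis
    using has_derivative_unique by metis
qed

text \<open>Each coordinate is split into its direction, which subconverges by compactness, and the
  logarithm \<open>u\<close> of its norm, to which the convergent-divergent splitting applies. The
  factor \<open>exp (v l)\<close> goes into \<open>y l\<close>, the rest into
  \<open>p l\<close>.\<close>

lemma subseq_torus_normal_form:
  fixes x :: "nat \<Rightarrow> 'a::euclidean_space ^ 'n::finite"
  assumes nz: "\<And>l i. x l $ i \<noteq> 0" and top: "filterlim (\<lambda>l. norm (x l)) at_top sequentially"
    and D: "finite D"
  obtains r p y a i where "strict_mono (r :: nat \<Rightarrow> nat)" "y \<longlonglongrightarrow> a"
    "\<forall>i. a $ i \<noteq> 0" "\<forall>l i. y l $ i \<noteq> 0" "\<forall>l. x (r l) = torus_scale (- p l) (y l)"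
    "filterlim (\<lambda>l. p l $ i) at_bot sequentially"
    "\<forall>d\<in>D. (\<forall>l. p l \<bullet> d = 0) \<or> filterlim (\<lambda>l. p l \<bullet> d) at_top sequentially \<or>
       filterlim (\<lambda>l. p l \<bullet> d) at_bot sequentially"
proof -
  define \<theta> where "\<theta> l = (\<chi> i. sgn (x l $ i))" for l
  have n\<theta>: "norm (\<theta> l $ i) = 1" for l i
    using nz by (simp add: \<theta>_def norm_sgn)
  have "norm (\<theta> l) \<le> real CARD('n)" for l
    unfolding norm_vec_def by (rule order_trans[OF L2_set_le_sum]) (auto simp: n\<theta>)
  then have "seq_compact (cball (0 :: 'a ^ 'n) (real CARD('n)))" "\<forall>l. \<theta> l \<in> cball 0 (real CARD('n))"
    by (auto simp: compact_imp_seq_compact)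
  then obtain \<theta>0 r1 where r1: "strict_mono r1" "(\<theta> \<circ> r1) \<longlonglongrightarrow> \<theta>0"
    by (rule seq_compactE)
  define u where "u l = (\<chi> i. ln (norm (x (r1 l) $ i)))" for l
  \<comment> \<open>The axis vectors make every coordinate of \<open>p l\<close> either identically
    zero or divergent with a definite sign.\<close>
  have "finite (D \<union> range (\<lambda>i. axis i 1))" using D by simp
  then obtain r2 v b where r2: "strict_mono r2" and v: "v \<longlonglongrightarrow> b"
    and tri: "\<forall>d \<in> D \<union> range (\<lambda>i. axis i 1). (\<forall>l. (v l - u (r2 l)) \<bullet> d = 0) \<or>
       filterlim (\<lambda>l. (v l - u (r2 l)) \<bullet> d) at_top sequentially \<or>
       filterlim (\<lambda>l. (v l - u (r2 l)) \<bullet> d) at_bot sequentially"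
    by (rule subseq_split_convergent_divergent[where u = u])
  define r where "r = r1 \<circ> r2"
  define p where "p l = v l - u (r2 l)" for l
  define y where "y l = torus_scale (v l) (\<theta> (r l))" for l
  have r: "strict_mono r"
    unfolding r_def by (rule strict_mono_o[OF r1(1) r2])
  have "(\<lambda>l. \<theta> (r l)) \<longlonglongrightarrow> \<theta>0"
    using LIMSEQ_subseq_LIMSEQ[OF r1(2) r2] by (simp add: r_def o_def)
  then have y: "y \<longlonglongrightarrow> torus_scale b \<theta>0"
    unfolding y_def[abs_def] torus_scale_def by (intro tendsto_intros v)
  have ny: "norm (y l $ i) = exp (v l $ i)" for l i
    by (simp add: y_def torus_scale_def n\<theta>)
  \<comment> \<open>The limit point lies in the torus because its coordinates have norm
    \<open>exp (b $ i)\<close>, which is positive.\<close>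
  have na: "norm (torus_scale b \<theta>0 $ i) = exp (b $ i)" for i
  proof (rule LIMSEQ_unique)
    show "(\<lambda>l. norm (y l $ i)) \<longlonglongrightarrow> norm (torus_scale b \<theta>0 $ i)"
      by (intro tendsto_intros y)
    show "(\<lambda>l. norm (y l $ i)) \<longlonglongrightarrow> exp (b $ i)"
      unfolding ny by (intro tendsto_intros v)
  qed
  have xy: "x (r l) = torus_scale (- p l) (y l)" for l
  proof (rule vec_eq_iff[THEN iffD2, rule_format])
    fix i
    have "exp (u (r2 l) $ i) = norm (x (r l) $ i)"
      using nz by (simp add: u_def r_def)
    then have "torus_scale (- p l) (y l) $ i = norm (x (r l) $ i) *\<^sub>R \<theta> (r l) $ i"
      by (simp add: torus_scale_def p_def y_def flip: exp_add)
    then show "x (r l) $ i = torus_scale (- p l) (y l) $ i"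
      using nz by (simp add: \<theta>_def sgn_div_norm)
  qed
  \<comment> \<open>Otherwise all coordinates of \<open>p l\<close> are eventually nonnegative,
    scaling by \<open>- p l\<close> does not increase norms, and the convergent \<open>y l\<close>
    bounds \<open>x (r l)\<close>.\<close>
  have "\<exists>i. filterlim (\<lambda>l. p l $ i) at_bot sequentially"
  proof (rule ccontr)
    assume no: "\<not> ?thesis"
    have "eventually (\<lambda>l. 0 \<le> p l $ i) sequentially" for i
      using bspec[OF tri, of "axis i 1"] no
      by (auto simp: inner_axis p_def[symmetric] filterlim_at_top)
    then have "eventually (\<lambda>l. \<forall>i. 0 \<le> p l $ i) sequentially"
      by (rule eventually_all_finite)
    moreover have "eventually (\<lambda>l. norm (y l) < norm (torus_scale b \<theta>0) + 1) sequentially"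
      by (rule order_tendstoD[OF tendsto_norm[OF y]]) simp
    moreover have "eventually (\<lambda>l. norm (x (r l)) \<ge> norm (torus_scale b \<theta>0) + 1) sequentially"
      using filterlim_compose[OF top filterlim_subseq[OF r]] by (simp add: filterlim_at_top)
    ultimately have "eventually (\<lambda>l. False) sequentially"
    proof eventually_elim
      case (elim l)
      have "norm (x (r l)) \<le> norm (y l)"
        unfolding norm_vec_def
      proof (rule L2_set_mono)
        fix i
        have "exp (- p l $ i) \<le> 1" using elim(1) by simp
        then show "norm (x (r l) $ i) \<le> norm (y l $ i)"
          by (simp add: xy torus_scale_def mult_left_le_one_le)
      qed simp
      then show False using elim by simp
    qed
    then show False by simp
  qed
  then obtain i where "filterlim (\<lambda>l. p l $ i) at_bot sequentially" by blast
  moreover have "torus_scale b \<theta>0 $ i \<noteq> 0" for i using na[of i] by auto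
  moreover have "y l $ i \<noteq> 0" for l i using ny[of l i] by auto
  moreover have "\<forall>d\<in>D. (\<forall>l. p l \<bullet> d = 0) \<or> filterlim (\<lambda>l. p l \<bullet> d) at_top sequentially \<or>
       filterlim (\<lambda>l. p l \<bullet> d) at_bot sequentially"
    using tri by (simp add: p_def)
  ultimately show thesis
    using that[OF r y, of p i] xy by simp
qed


section \<open>Sums of quasi-homogeneous terms\<close>

text \<open>A halfspace that contains the generators contains their convex hull, so minimality need
  only be tested on generators.\<close>

lemma min_face_iff:
  assumes "v \<in> insert 0 S"
  shows "v \<in> min_face S p \<longleftrightarrow> (\<forall>w\<in>insert 0 S. p \<bullet> v \<le> p \<bullet> w)"
proof -
  have "convex hull (insert 0 S) \<subseteq> {w. p \<bullet> v \<le> p \<bullet> w} \<longleftrightarrow> insert 0 S \<subseteq> {w. p \<bullet> v \<le> p \<bullet> w}"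
    using convex_halfspace_ge[where a = p and b = "p \<bullet> v"] by (simp add: subset_hull)
  then show ?thesis
    using hull_inc[OF assms, of convex] by (auto simp: min_face_def newton_polyhedron_def)
qed

text \<open>Common core of the three types: \<open>T j k\<close> is a term of the
  \<open>j\<close>-th component and \<open>wt k\<close> its exponent vector. \<open>wt\<close> need
  not be injective, since distinct mixed monomials may have the same exponent sum.\<close>

lemma K_infinity_quasihomogeneous_sums_empty:
  fixes K :: "'k::finite \<Rightarrow> 'i set" and wt :: "'i \<Rightarrow> real ^ 'n::finite"
    and T :: "'k \<Rightarrow> 'i \<Rightarrow> 'a::euclidean_space ^ 'n \<Rightarrow> 'a"
  assumes fin: "\<And>j. finite (K j)"
    and C1: "\<And>j k. \<exists>T'. C1_with (T j k) T'"
    and hom: "\<And>j k s x. T j k (torus_scale s x) = exp (s \<bullet> wt k) *\<^sub>R T j k x"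
    and nonneg: "\<And>k i. 0 \<le> wt k $ i"
    and nonzero: "\<And>j. 0 \<notin> wt ` K j"
    and conv: "\<And>j. convenient (wt ` K j)"
    and dual: "dual_subdivision (\<lambda>j. wt ` K j) C"
    and nondeg: "nondegenerate C (\<lambda>j. wt ` K j) (\<lambda>j \<Delta> x. \<Sum>k\<in>{k \<in> K j. wt k \<in> \<Delta>}. T j k x)"
  shows "K_infinity (\<lambda>x. \<chi> j. \<Sum>k\<in>K j. T j k x) = {}"
proof (rule equals0I)

  \<comment> \<open>Torus normal form of an asymptotic critical sequence\<close>
  let ?S = "\<lambda>j. wt ` K j"
  let ?F = "\<lambda>x. \<chi> j. \<Sum>k\<in>K j. T j k x"
  fix c assume c: "c \<in> K_infinity ?F"
  obtain T' where T': "\<And>j k. C1_with (T j k) (T' j k)"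
    using C1 by metis
  define F' where "F' x h = (\<chi> j. \<Sum>k\<in>K j. T' j k x h)" for x h
  have F': "C1_with ?F F'"
    unfolding F'_def[abs_def] by (intro C1_with_vec_lambda C1_with_sum T')
  have hom': "T' j k (torus_scale s x) (torus_scale s h) = exp (s \<bullet> wt k) *\<^sub>R T' j k x h" for j k s x h
    by (rule quasihomogeneous_derivative[OF T' hom])
  have linF': "linear (F' x)" for x
    using F' by (auto simp: C1_with_def dest: has_derivative_linear)
  obtain x \<phi> where nz: "\<And>l i. x l $ i \<noteq> 0" and top: "filterlim (\<lambda>l. norm (x l)) at_top sequentially"
    and Fc: "(\<lambda>l. ?F (x l)) \<longlonglongrightarrow> c" and \<phi>: "\<And>l. norm (\<phi> l) = 1"
    and adj: "(\<lambda>l. (1 + norm (x l)) * norm (adjoint (F' (x l)) (\<phi> l))) \<longlonglongrightarrow> 0"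
    using K_infinity_sequence[OF F' c] by blast
  \<comment> \<open>The signs of the pairings of a covector with these differences, \<open>0\<close>
    included as a generator, determine its minimal faces.\<close>
  define D where "D = (\<Union>j. (\<lambda>(v, w). v - w) ` (insert 0 (?S j) \<times> insert 0 (?S j)))"
  have D: "finite D" using fin by (auto simp: D_def)
  obtain r p y a i where r: "strict_mono r" and y: "y \<longlonglongrightarrow> a"
    and a: "\<forall>i. a $ i \<noteq> 0" and ny: "\<forall>l i. y l $ i \<noteq> 0"
    and xy: "\<forall>l. x (r l) = torus_scale (- p l) (y l)"
    and bot: "filterlim (\<lambda>l. p l $ i) at_bot sequentially"
    and tri: "\<forall>d\<in>D. (\<forall>l. p l \<bullet> d = 0) \<or> filterlim (\<lambda>l. p l \<bullet> d) at_top sequentially \<or>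
       filterlim (\<lambda>l. p l \<bullet> d) at_bot sequentially"
    by (rule subseq_torus_normal_form[OF nz top D])
  have D_diff: "v - w \<in> D" if "v \<in> insert 0 (?S j)" "w \<in> insert 0 (?S j)" for v w j
    unfolding D_def using that by force

  text \<open>All \<open>p l\<close> with \<open>l\<close> large have the same minimal faces, so any one of them will do.\<close>
  have "eventually (\<lambda>l. (p l \<bullet> d = 0 \<longrightarrow> (\<forall>l. p l \<bullet> d = 0)) \<and>
      (p l \<bullet> d > 0 \<longrightarrow> filterlim (\<lambda>l. p l \<bullet> d) at_top sequentially)) sequentially" if "d \<in> D" for d
    using bspec[OF tri that]
  proof (elim disjE)
    assume top: "filterlim (\<lambda>l. p l \<bullet> d) at_top sequentially"
    then have "eventually (\<lambda>l. p l \<bullet> d > 0) sequentially"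
      by (simp add: filterlim_at_top_dense)
    then show ?thesis by (rule eventually_mono) (simp add: top)
  next
    assume "filterlim (\<lambda>l. p l \<bullet> d) at_bot sequentially"
    then have "eventually (\<lambda>l. p l \<bullet> d < 0) sequentially"
      by (simp add: filterlim_at_bot_dense)
    then show ?thesis by (rule eventually_mono) simp
  qed auto
  then have "eventually (\<lambda>l. \<forall>d\<in>D. (p l \<bullet> d = 0 \<longrightarrow> (\<forall>l. p l \<bullet> d = 0)) \<and>
      (p l \<bullet> d > 0 \<longrightarrow> filterlim (\<lambda>l. p l \<bullet> d) at_top sequentially)) sequentially"
    by (intro eventually_ball_finite D) blast
  moreover have "eventually (\<lambda>l. p l $ i < 0) sequentially"
    using bot by (simp add: filterlim_at_bot_dense)
  ultimately have "eventually (\<lambda>l. (\<forall>d\<in>D. (p l \<bullet> d = 0 \<longrightarrow> (\<forall>l. p l \<bullet> d = 0)) \<and>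
      (p l \<bullet> d > 0 \<longrightarrow> filterlim (\<lambda>l. p l \<bullet> d) at_top sequentially)) \<and> p l $ i < 0) sequentially"
    by (rule eventually_conj)
  \<comment> \<open>At such an index \<open>L\<close> the sign of a pairing tells how the pairing
    behaves along the whole sequence.\<close>
  then obtain L where L: "\<And>d. d \<in> D \<Longrightarrow> p L \<bullet> d = 0 \<Longrightarrow> (\<forall>l. p l \<bullet> d = 0)"
      "\<And>d. d \<in> D \<Longrightarrow> p L \<bullet> d > 0 \<Longrightarrow> filterlim (\<lambda>l. p l \<bullet> d) at_top sequentially" "p L $ i < 0"
    using eventually_happens'[OF trivial_limit_sequentially] by blast

  \<comment> \<open>The faces selected by the sequence\<close>
  define q where "q = p L"
  define \<Delta> where "\<Delta> j = min_face (?S j) q" for j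

  \<comment> \<open>Convenience gives a support point on the axis \<open>i\<close>, where
    \<open>q\<close> is negative. So the minimum over the generators is negative and is attained at
    a support point, not at \<open>0\<close>.\<close>
  have "\<exists>e. e \<in> ?S j \<and> e \<in> \<Delta> j \<and> q \<bullet> e < 0" for j
  proof -
    obtain v t where v: "v \<in> ?S j" "v = axis i t"
      using conv[of j] unfolding convenient_def by blast
    have "t \<ge> 0" using v nonneg by (metis axis_nth imageE)
    moreover have "t \<noteq> 0" using v nonzero by (metis axis_eq_0_iff)
    ultimately have neg: "q \<bullet> v < 0"
      using L(3) v by (simp add: inner_axis q_def mult_neg_pos)
    have ins: "finite (insert 0 (?S j))" "insert 0 (?S j) \<noteq> {}" using fin by auto
    define e where "e = arg_min_on ((\<bullet>) q) (insert 0 (?S j))"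
    have e: "e \<in> insert 0 (?S j)" "\<And>w. w \<in> insert 0 (?S j) \<Longrightarrow> q \<bullet> e \<le> q \<bullet> w"
      unfolding e_def using arg_min_if_finite(1)[OF ins] arg_min_least[OF ins] by blast+
    then have "q \<bullet> e < 0" using neg v(1) by (meson insertCI order_le_less_trans)
    then show ?thesis
      using e min_face_iff[OF e(1), of q] by (auto simp: \<Delta>_def)
  qed
  then obtain e where e: "\<And>j. e j \<in> ?S j" "\<And>j. e j \<in> \<Delta> j" "\<And>j. q \<bullet> e j < 0"
    by metis
  have zero_face: "0 \<notin> \<Delta> j" for j
    using e(3)[of j] e(1)[of j] min_face_iff[of 0 "?S j" q] by (force simp: \<Delta>_def)

  obtain \<sigma> where \<sigma>: "\<sigma> \<in> C" "q \<in> \<sigma>"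
  proof -
    have "q \<in> dual_domain" using L(3) by (auto simp: dual_domain_def q_def not_le)
    moreover have "\<Union>C = dual_domain"
      using dual by (auto simp: dual_subdivision_def refines_def partition_on_def)
    ultimately show thesis using that by blast
  qed
  have face: "cone_face ?S \<sigma> j = \<Delta> j" for j
    unfolding \<Delta>_def by (rule cone_face_eq[OF dual \<sigma>])
  have "cone_I ?S \<sigma> = UNIV" "cone_J ?S \<sigma> = {}"
    using zero_face e(2) by (auto simp: cone_I_def cone_J_def face)
  then have nondeg': "a \<notin> sing UNIV (\<lambda>j x. \<Sum>k\<in>{k \<in> K j. wt k \<in> \<Delta> j}. T j k x) \<or>
      a \<notin> face_zeros ?S (\<lambda>j \<Delta> x. \<Sum>k\<in>{k \<in> K j. wt k \<in> \<Delta>}. T j k x) \<sigma>"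
    using bspec[OF nondeg[unfolded nondegenerate_def] \<sigma>(1)] by (auto simp: face)

  \<comment> \<open>Asymptotics of the rescaled terms\<close>
  define m where "m j l = p l \<bullet> e j" for j l
  have m_bot: "filterlim (m j) at_bot sequentially" for j
    using L(2)[of "0 - e j"] D_diff[of 0 j "e j"] e(1,3)[of j]
    by (simp add: m_def[abs_def] q_def filterlim_uminus_at_bot)
  \<comment> \<open>Size of the \<open>k\<close>-th monomial relative to the leading one,
    \<open>exp (- m j l)\<close>. On the face the exponent is identically \<open>0\<close>; off the
    face it tends to minus infinity.\<close>
  define \<omega> where "\<omega> j k l = exp (m j l - p l \<bullet> wt k)" for j k l
  have \<omega>: "\<omega> j k \<longlonglongrightarrow> (if wt k \<in> \<Delta> j then 1 else 0)" if k: "k \<in> K j" for j k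
  proof -
    have d: "wt k - e j \<in> D"
      using D_diff e(1) k by blast
    have le: "q \<bullet> e j \<le> q \<bullet> wt k"
      using e(1,2)[of j] k min_face_iff[of "e j" "?S j" q] by (auto simp: \<Delta>_def)
    show ?thesis
    proof (cases "wt k \<in> \<Delta> j")
      case True
      then have "q \<bullet> wt k \<le> q \<bullet> e j"
        using k e(1)[of j] min_face_iff[of "wt k" "?S j" q] by (auto simp: \<Delta>_def)
      with le have "p L \<bullet> (wt k - e j) = 0"
        by (simp add: q_def inner_diff_right)
      then have "p l \<bullet> (wt k - e j) = 0" for l
        using L(1)[OF d] by blast
      then have "\<omega> j k l = 1" for l
        unfolding \<omega>_def m_def inner_diff_right by simp
      then show ?thesis using True by (simp add: LIMSEQ_I)
    next
      case False
      have "q \<bullet> e j \<noteq> q \<bullet> wt k"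
      proof
        assume "q \<bullet> e j = q \<bullet> wt k"
        then have "wt k \<in> \<Delta> j"
          using k e(1,2)[of j] min_face_iff[of "wt k" "?S j" q] min_face_iff[of "e j" "?S j" q]
          by (auto simp: \<Delta>_def)
        with False show False by blast
      qed
      with le have "p L \<bullet> (wt k - e j) > 0"
        by (simp add: q_def inner_diff_right)
      then have "filterlim (\<lambda>l. p l \<bullet> (wt k - e j)) at_top sequentially"
        by (rule L(2)[OF d])
      then have "filterlim (\<lambda>l. m j l - p l \<bullet> wt k) at_bot sequentially"
        by (simp add: m_def inner_diff_right filterlim_uminus_at_bot)
      then have "\<omega> j k \<longlonglongrightarrow> 0"
        unfolding \<omega>_def[abs_def] by (rule filterlim_compose[OF exp_at_bot])
      then show ?thesis using False by simp
    qed
  qed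
  have dominant: "(\<lambda>l. \<Sum>k\<in>K j. \<omega> j k l *\<^sub>R A k l) \<longlonglongrightarrow> (\<Sum>k\<in>{k \<in> K j. wt k \<in> \<Delta> j}. B k)"
    if "\<And>k. k \<in> K j \<Longrightarrow> A k \<longlonglongrightarrow> B k" for j and A :: "'i \<Rightarrow> nat \<Rightarrow> 'a" and B
  proof -
    have "(\<lambda>l. \<Sum>k\<in>K j. \<omega> j k l *\<^sub>R A k l) \<longlonglongrightarrow>
        (\<Sum>k\<in>K j. (if wt k \<in> \<Delta> j then 1 else 0) *\<^sub>R B k)"
      by (intro tendsto_sum tendsto_scaleR \<omega> that)
    also have "(\<Sum>k\<in>K j. (if wt k \<in> \<Delta> j then 1 else 0) *\<^sub>R B k) = (\<Sum>k\<in>{k \<in> K j. wt k \<in> \<Delta> j}. B k)"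
      unfolding sum.inter_filter[OF fin] by (rule sum.cong) auto
    finally show ?thesis .
  qed
  have Ty: "(\<lambda>l. T j k (y l)) \<longlonglongrightarrow> T j k a" for j k
    by (rule continuous_on_tendsto_compose[OF C1_with_continuous[OF T'] y]) auto
  have T'y: "(\<lambda>l. T' j k (y l) w) \<longlonglongrightarrow> T' j k a w" for j k w
    using T'[unfolded C1_with_def]
    by (intro continuous_on_tendsto_compose[where f = "\<lambda>x. T' j k x w", OF _ y]) auto

  \<comment> \<open>Vanishing of the truncations at the limit point\<close>
  have "(\<Sum>k\<in>{k \<in> K j. wt k \<in> \<Delta> j}. T j k a) = 0" for j
  proof (rule LIMSEQ_unique)
    show "(\<lambda>l. \<Sum>k\<in>K j. \<omega> j k l *\<^sub>R T j k (y l)) \<longlonglongrightarrow> (\<Sum>k\<in>{k \<in> K j. wt k \<in> \<Delta> j}. T j k a)"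
      by (rule dominant[OF Ty])
    \<comment> \<open>The components of \<open>F\<close> converge while the normalising factor tends
      to \<open>0\<close>.\<close>
    have "(\<lambda>l. exp (m j l) *\<^sub>R (?F (x (r l)) $ j)) \<longlonglongrightarrow> 0 *\<^sub>R (c $ j)"
      using LIMSEQ_subseq_LIMSEQ[OF Fc r]
      by (intro tendsto_scaleR filterlim_compose[OF exp_at_bot m_bot] tendsto_vec_nth) (simp add: o_def)
    moreover have "exp (m j l) *\<^sub>R (?F (x (r l)) $ j) = (\<Sum>k\<in>K j. \<omega> j k l *\<^sub>R T j k (y l))" for l
      by (simp add: xy hom \<omega>_def scaleR_sum_right flip: exp_add)
    ultimately show "(\<lambda>l. \<Sum>k\<in>K j. \<omega> j k l *\<^sub>R T j k (y l)) \<longlonglongrightarrow> 0"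
      by simp
  qed
  then have "a \<in> face_zeros ?S (\<lambda>j \<Delta> x. \<Sum>k\<in>{k \<in> K j. wt k \<in> \<Delta>}. T j k x) \<sigma>"
    using a by (simp add: face_zeros_def face)
  with nondeg' have nsing: "a \<notin> sing UNIV (\<lambda>j x. \<Sum>k\<in>{k \<in> K j. wt k \<in> \<Delta> j}. T j k x)"
    by blast

  \<comment> \<open>The limit covector\<close>
  define \<zeta> where "\<zeta> l = (\<chi> j. exp (- m j l) *\<^sub>R \<phi> (r l) $ j)" for l
  have "eventually (\<lambda>l. m j l \<le> 0) sequentially" for j
    using m_bot[of j] by (simp add: filterlim_at_bot)
  then have "eventually (\<lambda>l. \<forall>j. m j l \<le> 0) sequentially"
    by (rule eventually_all_finite)
  \<comment> \<open>The factors \<open>exp (- m j l)\<close> are eventually at least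
    \<open>1\<close>, so rescaling does not shrink the unit covector
    \<open>\<phi> (r l)\<close>.\<close>
  then have \<zeta>1: "eventually (\<lambda>l. 1 \<le> norm (\<zeta> l)) sequentially"
  proof eventually_elim
    case (elim l)
    have "norm (\<phi> (r l)) \<le> norm (\<zeta> l)"
      unfolding norm_vec_def
    proof (rule L2_set_mono)
      fix j
      have "1 \<le> exp (- m j l)" using elim by simp
      from mult_right_mono[OF this norm_ge_zero, of "\<phi> (r l) $ j"]
      show "norm (\<phi> (r l) $ j) \<le> norm (\<zeta> l $ j)" by (simp add: \<zeta>_def)
    qed simp
    then show ?case by (simp add: \<phi>)
  qed
  define \<Phi> where "\<Phi> w l = (\<chi> j. \<Sum>k\<in>K j. \<omega> j k l *\<^sub>R T' j k (y l) w)" for w l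
  define \<Phi>0 where "\<Phi>0 w = (\<chi> j. \<Sum>k\<in>{k \<in> K j. wt k \<in> \<Delta> j}. T' j k a w)" for w
  have \<Phi>: "\<Phi> w \<longlonglongrightarrow> \<Phi>0 w" for w
    unfolding \<Phi>_def[abs_def] \<Phi>0_def by (intro tendsto_vec_lambda dominant T'y)
  \<comment> \<open>The factor \<open>exp (- m j l)\<close> in \<zeta> cancels the
    \<open>exp (m j l)\<close> in \<omega>; what remains is the derivative of the original map in a
    scaled direction.\<close>
  have \<zeta>\<Phi>: "\<zeta> l \<bullet> \<Phi> w l = \<phi> (r l) \<bullet> F' (x (r l)) (torus_scale (- p l) w)" for w l
  proof -
    have "\<zeta> l $ j \<bullet> \<Phi> w l $ j = \<phi> (r l) $ j \<bullet> F' (x (r l)) (torus_scale (- p l) w) $ j" for j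
    proof -
      have "exp (- m j l) *\<^sub>R \<Phi> w l $ j = F' (x (r l)) (torus_scale (- p l) w) $ j"
        by (simp add: \<Phi>_def F'_def xy hom' \<omega>_def scaleR_sum_right flip: exp_add)
      then show ?thesis by (simp add: \<zeta>_def flip: inner_scaleR_right)
    qed
    then show ?thesis by (simp add: inner_vec_def)
  qed
  have lim0: "(\<lambda>l. \<zeta> l \<bullet> \<Phi> w l) \<longlonglongrightarrow> 0" for w
  proof (rule tendsto_rabs_zero_cancel, rule tendsto_sandwich[OF _ _ tendsto_const])
    \<comment> \<open>A scaled direction has coordinates of norm
      \<open>norm (x (r l) $ i) * norm (w $ i) / norm (y l $ i)\<close>, so it grows at most like
      \<open>1 + norm (x (r l))\<close>, exactly the weight in \<open>K_infinity\<close>. The sum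
      \<open>?c l\<close> converges because \<open>a\<close> lies in the torus.\<close>
    let ?c = "\<lambda>l. \<Sum>i\<in>UNIV. norm (w $ i) / norm (y l $ i)"
    let ?n = "\<lambda>l. (1 + norm (x (r l))) * norm (adjoint (F' (x (r l))) (\<phi> (r l)))"
    have bound: "\<bar>\<zeta> l \<bullet> \<Phi> w l\<bar> \<le> ?n l * ?c l" for l
    proof -
      have "norm (torus_scale (- p l) w) \<le> (\<Sum>i\<in>UNIV. norm (torus_scale (- p l) w $ i))"
        unfolding norm_vec_def by (rule L2_set_le_sum) simp
      also have "\<dots> \<le> (\<Sum>i\<in>UNIV. (1 + norm (x (r l))) * (norm (w $ i) / norm (y l $ i)))"
      proof (rule sum_mono)
        fix i
        have "norm (torus_scale (- p l) w $ i) = norm (x (r l) $ i) * (norm (w $ i) / norm (y l $ i))"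
          using ny by (simp add: xy torus_scale_def)
        also have "\<dots> \<le> (1 + norm (x (r l))) * (norm (w $ i) / norm (y l $ i))"
          using Finite_Cartesian_Product.norm_nth_le[of "x (r l)" i]
          by (intro mult_right_mono) auto
        finally show "norm (torus_scale (- p l) w $ i) \<le> (1 + norm (x (r l))) * (norm (w $ i) / norm (y l $ i))" .
      qed
      finally have n: "norm (torus_scale (- p l) w) \<le> (1 + norm (x (r l))) * ?c l"
        by (simp add: sum_distrib_left)
      have "\<zeta> l \<bullet> \<Phi> w l = adjoint (F' (x (r l))) (\<phi> (r l)) \<bullet> torus_scale (- p l) w"
        unfolding \<zeta>\<Phi> using adjoint_works[OF linF'] by (metis inner_commute)
      then have "\<bar>\<zeta> l \<bullet> \<Phi> w l\<bar> \<le> norm (adjoint (F' (x (r l))) (\<phi> (r l))) * norm (torus_scale (- p l) w)"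
        using Cauchy_Schwarz_ineq2 by metis
      also have "\<dots> \<le> norm (adjoint (F' (x (r l))) (\<phi> (r l))) * ((1 + norm (x (r l))) * ?c l)"
        by (rule mult_left_mono[OF n norm_ge_zero])
      finally show ?thesis by (simp only: mult_ac)
    qed
    show "eventually (\<lambda>l. 0 \<le> \<bar>\<zeta> l \<bullet> \<Phi> w l\<bar>) sequentially" by simp
    show "eventually (\<lambda>l. \<bar>\<zeta> l \<bullet> \<Phi> w l\<bar> \<le> ?n l * ?c l) sequentially"
      using bound by (intro always_eventually allI)
    have "(\<lambda>l. ?n l * ?c l) \<longlonglongrightarrow> 0 * (\<Sum>i\<in>UNIV. norm (w $ i) / norm (a $ i))"
      using LIMSEQ_subseq_LIMSEQ[OF adj r] a y
      by (intro tendsto_mult tendsto_sum tendsto_divide tendsto_norm tendsto_vec_nth) (auto simp: o_def)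
    then show "(\<lambda>l. ?n l * ?c l) \<longlonglongrightarrow> 0" by simp
  qed
  \<comment> \<open>\<zeta> may be unbounded, so it is normalised before passing to a limit.\<close>
  have "seq_compact (cball (0 :: 'a ^ 'k) 1)" "\<forall>l. sgn (\<zeta> l) \<in> cball 0 1"
    by (auto simp: compact_imp_seq_compact norm_sgn)
  then obtain \<psi> s where s: "strict_mono s" "((\<lambda>l. sgn (\<zeta> l)) \<circ> s) \<longlonglongrightarrow> \<psi>"
    by (rule seq_compactE)
  have "(\<lambda>l. norm (sgn (\<zeta> (s l)))) \<longlonglongrightarrow> 1"
  proof (rule tendsto_eventually)
    have "eventually (\<lambda>l. norm (sgn (\<zeta> l)) = 1) sequentially"
      using \<zeta>1 by eventually_elim (auto simp: norm_sgn)
    then show "eventually (\<lambda>l. norm (sgn (\<zeta> (s l))) = 1) sequentially"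
      by (rule eventually_subseq[OF s(1)])
  qed
  moreover have "(\<lambda>l. norm (sgn (\<zeta> (s l)))) \<longlonglongrightarrow> norm \<psi>"
    using s(2) by (intro tendsto_norm) (simp add: o_def)
  ultimately have \<psi>: "norm \<psi> = 1" using LIMSEQ_unique by blast
  have \<psi>\<Phi>0: "\<psi> \<bullet> \<Phi>0 w = 0" for w
  proof (rule LIMSEQ_unique)
    show "(\<lambda>l. sgn (\<zeta> (s l)) \<bullet> \<Phi> w (s l)) \<longlonglongrightarrow> \<psi> \<bullet> \<Phi>0 w"
      using s(2) LIMSEQ_subseq_LIMSEQ[OF \<Phi> s(1)] by (intro tendsto_inner) (simp_all add: o_def)
    \<comment> \<open>Since eventually \<open>1 \<le> norm (\<zeta> l)\<close>, normalising cannot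
      enlarge the pairing.\<close>
    have "(\<lambda>l. sgn (\<zeta> l) \<bullet> \<Phi> w l) \<longlonglongrightarrow> 0"
    proof (rule Lim_null_comparison[OF _ tendsto_rabs_zero[OF lim0]])
      show "eventually (\<lambda>l. norm (sgn (\<zeta> l) \<bullet> \<Phi> w l) \<le> \<bar>\<zeta> l \<bullet> \<Phi> w l\<bar>) sequentially"
        using \<zeta>1
      proof eventually_elim
        case (elim l)
        then have "inverse (norm (\<zeta> l)) \<le> 1" by (simp add: inverse_le_1_iff)
        then show ?case
          by (simp add: sgn_div_norm abs_mult mult_left_le_one_le)
      qed
    qed
    from LIMSEQ_subseq_LIMSEQ[OF this s(1)]
    show "(\<lambda>l. sgn (\<zeta> (s l)) \<bullet> \<Phi> w (s l)) \<longlonglongrightarrow> 0" by (simp add: o_def)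
  qed
  have "C1_with (\<lambda>x. \<chi> j. \<Sum>k\<in>{k \<in> K j. wt k \<in> \<Delta> j}. T j k x)
     (\<lambda>x h. \<chi> j. \<Sum>k\<in>{k \<in> K j. wt k \<in> \<Delta> j}. T' j k x h)"
    by (intro C1_with_vec_lambda C1_with_sum T')
  then have "frechet_derivative (\<lambda>x. \<chi> j. \<Sum>k\<in>{k \<in> K j. wt k \<in> \<Delta> j}. T j k x) (at a) = \<Phi>0"
    unfolding \<Phi>0_def C1_with_def by (intro frechet_derivative_at[symmetric]) blast
  then have "range \<Phi>0 = UNIV"
    using nsing by (simp add: sing_def)
  \<comment> \<open>Surjectivity puts \<psi> itself into the range that it annihilates, so \<psi>
    would be orthogonal to itself.\<close>
  then obtain w where "\<psi> = \<Phi>0 w" by (metis surjD)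
  with \<psi>\<Phi>0[of w] \<psi> show False by simp
qed


section \<open>Polynomial and mixed mappings\<close>

lemma monomial_torus_scale:
  fixes x :: "'a::real_normed_field ^ 'n::finite"
  shows "monomial (torus_scale s x) \<nu> = exp (s \<bullet> lattice_point \<nu>) *\<^sub>R monomial x \<nu>"
proof -
  have "exp (s \<bullet> lattice_point \<nu>) = (\<Prod>i\<in>UNIV. exp (s $ i) ^ (\<nu> $ i))"
    by (simp add: inner_vec_def lattice_point_def exp_sum exp_of_nat_mult[symmetric] mult.commute)
  then show ?thesis
    by (simp add: monomial_def torus_scale_def scaleR_conv_of_real power_mult_distrib prod.distrib)
qed

lemma monomial_0: "monomial (0 :: 'a::comm_ring_1 ^ 'n::finite) \<nu> = (if \<nu> = 0 then 1 else 0)"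
  by (auto simp: monomial_def vec_eq_iff power_0_left intro!: prod_zero)

lemma lattice_point_eq_0_iff [simp]: "lattice_point \<nu> = 0 \<longleftrightarrow> \<nu> = 0"
  by (auto simp: lattice_point_def vec_eq_iff)

lemma C1_monomial:
  "\<exists>T'. C1_with (\<lambda>x. monomial (x :: 'a::{real_normed_field, euclidean_space} ^ 'n::finite) \<nu>) T'"
proof -
  \<comment> \<open>A power is written as a product of equal factors so that the product rule covers
    it.\<close>
  have "\<exists>f'. C1_with (\<lambda>x :: 'a ^ 'n. \<Prod>m\<in>{..<\<nu> $ i}. x $ i) f'" for i
    by (rule C1_with_prod) (blast intro: C1_with_bounded_linear bounded_linear_vec_nth)
  then have "\<exists>f'. C1_with (\<lambda>x :: 'a ^ 'n. (x $ i) ^ (\<nu> $ i)) f'" for i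
    by simp
  then show ?thesis
    unfolding monomial_def by (intro C1_with_prod)
qed

lemma vec_cnj_torus_scale: "vec_cnj (torus_scale s z) = torus_scale s (vec_cnj z)"
  by (simp add: vec_cnj_def torus_scale_def)

lemma C1_monomial_vec_cnj: "\<exists>T'. C1_with (\<lambda>z :: complex ^ 'n::finite. monomial (vec_cnj z) \<nu>) T'"
proof -
  have "\<exists>f'. C1_with (\<lambda>z :: complex ^ 'n. \<Prod>m\<in>{..<\<nu> $ i}. cnj (z $ i)) f'" for i
    by (rule C1_with_prod)
       (blast intro: C1_with_bounded_linear bounded_linear_compose[OF bounded_linear_cnj bounded_linear_vec_nth])
  then have "\<exists>f'. C1_with (\<lambda>z :: complex ^ 'n. (vec_cnj z $ i) ^ (\<nu> $ i)) f'" for i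
    by (simp add: vec_cnj_def)
  then show ?thesis
    unfolding monomial_def by (intro C1_with_prod)
qed

text \<open>The type class of \<open>'a\<close> covers real and complex coefficients at once; terms
  are indexed by their exponents.\<close>

lemma K_infinity_poly_map_empty:
  fixes P :: "'k::finite \<Rightarrow> ('a::{real_normed_field, euclidean_space}, 'n::finite) polyn"
  assumes "poly_map P 0 = 0" and "dual_subdivision (\<lambda>j. poly_supp (P j)) C"
    and "poly_nondegenerate_at_infinity C P" and "\<And>j. convenient (poly_supp (P j))"
  shows "K_infinity (poly_map P) = {}"
proof -
  let ?T = "\<lambda>j \<nu> x. Poly_Mapping.lookup (P j) \<nu> * monomial x \<nu>"
  have "K_infinity (\<lambda>x. \<chi> j. \<Sum>\<nu>\<in>Poly_Mapping.keys (P j). ?T j \<nu> x) = {}"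
  proof (rule K_infinity_quasihomogeneous_sums_empty[where wt = lattice_point and C = C])
    show "\<exists>T'. C1_with (?T j \<nu>) T'" for j \<nu>
      using C1_monomial[of \<nu>] C1_with_mult[OF C1_with_const] by blast
    show "?T j \<nu> (torus_scale s x) = exp (s \<bullet> lattice_point \<nu>) *\<^sub>R ?T j \<nu> x" for j \<nu> s x
      by (simp add: monomial_torus_scale)
    \<comment> \<open>Evaluation at the origin isolates the constant coefficient.\<close>
    show "0 \<notin> lattice_point ` Poly_Mapping.keys (P j)" for j
    proof -
      have "poly_eval (P j) 0 = 0"
        using assms(1) by (simp add: poly_map_def vec_eq_iff)
      then have "Poly_Mapping.lookup (P j) 0 = 0"
        by (simp add: poly_eval_def monomial_0 if_distrib[where f = "(*) _"] sum.delta'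
            in_keys_iff split: if_splits cong: if_cong)
      then show ?thesis by (auto simp: in_keys_iff)
    qed
    show "nondegenerate C (\<lambda>j. lattice_point ` Poly_Mapping.keys (P j))
        (\<lambda>j \<Delta> x. \<Sum>\<nu>\<in>{\<nu> \<in> Poly_Mapping.keys (P j). lattice_point \<nu> \<in> \<Delta>}. ?T j \<nu> x)"
      using assms(3) unfolding poly_nondegenerate_at_infinity_def poly_supp_def poly_face_def .
  qed (use assms in \<open>auto simp: poly_supp_def lattice_point_def\<close>)
  then show ?thesis
    unfolding poly_map_def poly_eval_def .
qed

text \<open>Positive real scaling acts alike on a variable and its conjugate, so the term indexed by
  \<open>(\<nu>, \<mu>)\<close> has weight \<open>\<nu> + \<mu>\<close>.\<close>

lemma K_infinity_mixed_map_empty: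
  fixes M :: "'k::finite \<Rightarrow> 'n::finite mixed_polyn"
  assumes "mixed_map M 0 = 0" and "dual_subdivision (\<lambda>j. mixed_supp (M j)) C"
    and "mixed_nondegenerate_at_infinity C M" and "\<And>j. convenient (mixed_supp (M j))"
  shows "K_infinity (mixed_map M) = {}"
proof -
  let ?T = "\<lambda>j (\<nu>, \<mu>) z. Poly_Mapping.lookup (M j) (\<nu>, \<mu>) * monomial z \<nu> * monomial (vec_cnj z) \<mu>"
  let ?wt = "\<lambda>(\<nu>, \<mu>). lattice_point (\<nu> + \<mu>)"
  have eval: "mixed_eval (M j) z = (\<Sum>k\<in>Poly_Mapping.keys (M j). ?T j k z)" for j z
    unfolding mixed_eval_def by (rule sum.cong) auto
  have face: "mixed_face (M j) \<Delta> z = (\<Sum>k\<in>{k \<in> Poly_Mapping.keys (M j). ?wt k \<in> \<Delta>}. ?T j k z)" for j \<Delta> z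
    unfolding mixed_face_def by (rule sum.cong) auto
  have "K_infinity (\<lambda>z. \<chi> j. \<Sum>k\<in>Poly_Mapping.keys (M j). ?T j k z) = {}"
  proof (rule K_infinity_quasihomogeneous_sums_empty[where wt = ?wt and C = C])
    show "\<exists>T'. C1_with (?T j k) T'" for j k
    proof (cases k)
      case (Pair \<nu> \<mu>)
      obtain f' g' where "C1_with (\<lambda>z :: complex ^ 'n. monomial z \<nu>) f'"
          "C1_with (\<lambda>z :: complex ^ 'n. monomial (vec_cnj z) \<mu>) g'"
        using C1_monomial C1_monomial_vec_cnj by metis
      from C1_with_mult[OF C1_with_mult[OF C1_with_const this(1)] this(2)] Pair
      show ?thesis by auto
    qed
    show "?T j k (torus_scale s x) = exp (s \<bullet> ?wt k) *\<^sub>R ?T j k x" for j k s x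
    proof (cases k)
      case (Pair \<nu> \<mu>)
      have "lattice_point (\<nu> + \<mu>) = lattice_point \<nu> + lattice_point \<mu>"
        by (simp add: lattice_point_def vec_eq_iff)
      then show ?thesis
        by (simp add: Pair monomial_torus_scale vec_cnj_torus_scale inner_add_right exp_add mult.commute)
    qed
    show "0 \<notin> ?wt ` Poly_Mapping.keys (M j)" for j
    proof -
      have "mixed_eval (M j) 0 = 0"
        using assms(1) by (simp add: mixed_map_def vec_eq_iff)
      moreover have "vec_cnj 0 = (0 :: complex ^ 'n)"
        by (simp add: vec_cnj_def vec_eq_iff)
      then have "?T j k 0 = (if k = 0 then Poly_Mapping.lookup (M j) 0 else 0)" for k
        by (cases k) (auto simp: monomial_0 zero_prod_def)
      ultimately have "Poly_Mapping.lookup (M j) 0 = 0"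
        by (simp add: eval sum.delta' in_keys_iff split: if_splits)
      \<comment> \<open>Natural exponents cannot cancel, so only the constant term has weight
        \<open>0\<close>.\<close>
      moreover have "\<nu> + \<mu> = 0 \<longleftrightarrow> (\<nu>, \<mu>) = 0" for \<nu> \<mu> :: "nat ^ 'n"
        by (auto simp: vec_eq_iff zero_prod_def)
      ultimately show ?thesis by (auto simp: in_keys_iff)
    qed
    show "nondegenerate C (\<lambda>j. ?wt ` Poly_Mapping.keys (M j))
        (\<lambda>j \<Delta> z. \<Sum>k\<in>{k \<in> Poly_Mapping.keys (M j). ?wt k \<in> \<Delta>}. ?T j k z)"
      using assms(3) unfolding mixed_nondegenerate_at_infinity_def mixed_supp_def face[abs_def] .
  qed (use assms in \<open>auto simp: mixed_supp_def lattice_point_def\<close>)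
  then show ?thesis
    unfolding mixed_map_def eval .
qed

text \<open>\<open>C\<close> is an arbitrary dual subdivision, so the result is independent of how
  the classes are cut into cones; \<open>dual_subdivision_exists\<close> provides one.\<close>

theorem corollary1p3:
  fixes P :: "'k::finite \<Rightarrow> (real, 'n::finite) polyn"
    and Q :: "'k \<Rightarrow> (complex, 'n) polyn"
    and M :: "'k \<Rightarrow> 'n mixed_polyn"
    and C :: "(real ^ 'n) set set"
  assumes "CARD('k) \<le> CARD('n)"
  shows
    "(poly_map P 0 = 0 \<and>
      dual_subdivision (\<lambda>j. poly_supp (P j)) C \<and>
      poly_nondegenerate_at_infinity C P \<and>
      (\<forall>j. convenient (poly_supp (P j)))
      \<longrightarrow> K_infinity (poly_map P) = {}) \<and>
     (poly_map Q 0 = 0 \<and>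
      dual_subdivision (\<lambda>j. poly_supp (Q j)) C \<and>
      poly_nondegenerate_at_infinity C Q \<and>
      (\<forall>j. convenient (poly_supp (Q j)))
      \<longrightarrow> K_infinity (poly_map Q) = {}) \<and>
     (mixed_map M 0 = 0 \<and>
      dual_subdivision (\<lambda>j. mixed_supp (M j)) C \<and>
      mixed_nondegenerate_at_infinity C M \<and>
      (\<forall>j. convenient (mixed_supp (M j)))
      \<longrightarrow> K_infinity (mixed_map M) = {})"
proof (intro conjI impI)
  assume "poly_map P 0 = 0 \<and> dual_subdivision (\<lambda>j. poly_supp (P j)) C \<and>
    poly_nondegenerate_at_infinity C P \<and> (\<forall>j. convenient (poly_supp (P j)))"
  then show "K_infinity (poly_map P) = {}" by (intro K_infinity_poly_map_empty) auto
next
  assume "poly_map Q 0 = 0 \<and> dual_subdivision (\<lambda>j. poly_supp (Q j)) C \<and>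
    poly_nondegenerate_at_infinity C Q \<and> (\<forall>j. convenient (poly_supp (Q j)))"
  then show "K_infinity (poly_map Q) = {}" by (intro K_infinity_poly_map_empty) auto
next
  assume "mixed_map M 0 = 0 \<and> dual_subdivision (\<lambda>j. mixed_supp (M j)) C \<and>
    mixed_nondegenerate_at_infinity C M \<and> (\<forall>j. convenient (mixed_supp (M j)))"
  then show "K_infinity (mixed_map M) = {}" by (intro K_infinity_mixed_map_empty) auto
qed

end
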